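(* Let $A\in\mathbb{R}^{r\times s}$, $B\in\mathbb{R}^{r\times m}$, $C\in\mathbb{R}^{n\times s}$, $c\in\mathbb{R}$, $\mu\ge 0$; put $q=\min\{m,n\}$, $\bar q=\min\{r,s\}$, $r_b=\mathrm{rank}(B)$, $r_c=\mathrm{rank}(C)$, $p=\min\{r_b,r_c\}$. Let $\|\cdot\|_{\rm UI}$ be a unitarily invariant norm on $\mathbb{R}^{r\times s}$ with associated symmetric gauge function $\phi:\mathbb{R}^{\bar q}\to\mathbb{R}_+$ (so $\|Z\|_{\rm UI}=\phi(\sigma(Z))$). Assume: (i) $F$ and $G$ are spectral functions on $\mathbb{R}^{m\times n}$, $F(X)=f(\sigma(X))$ and $G(X)=g(\sigma(X))$, with $f,g:\mathbb{R}^q\to(-\infty,\infty]$ proper and absolutely symmetric; (ii) $\ell:\mathbb{R}_+\to(-\infty,\infty]$ is proper and non-decreasing; (iii) $f$ and $g$ are monotone under weak majorization on $\mathbb{R}^q_+$; (iv) $(I-P_B)AP_C=0$ and $P_BA(I-P_C)=0$, where $P_B$ and $P_C$ are the orthogonal projectors onto the column space of $B$ and the row space of $C$, respectively; (v) there exist thin SVDs $B=U_B\Sigma_BV_B^T$ and $C=U_C\Sigma_CV_C^T$ such that $\widetilde A:=U_B^TAV_C\in\mathbb{R}^{r_b\times r_c}$ is generalized diagonal, i.e. $\widetilde A_{ij}=0$ for $i\neq j$. Fix such a pair of thin SVDs. Consider the matrix problem $$(\mathrm{P})\qquad\min_{X\in\mathbb{R}^{m\times n}}\ \ell(\|A-BXC\|_{\rm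 UI})+\mu F(X)\quad\text{s.t.}\quad G(X)\le c$$ and the vector problem $$(\mathrm{V})\qquad\min_{x\in\mathbb{R}^p}\ \ell\big(\phi(\omega(x))\big)+\mu f\!\left(\begin{bmatrix}x\\ \mathbf{0}_{q-p}\end{bmatrix}\right)\quad\text{s.t.}\quad g\!\left(\begin{bmatrix}x\\ \mathbf{0}_{q-p}\end{bmatrix}\right)\le c,$$ where $$\omega(x)=\sigma\!\left(\begin{bmatrix}\widetilde A-\Sigma_B\,\mathrm{Diag}(x)\,\Sigma_C&0\\0&(U_B^\perp)^TAV_C^\perp\end{bmatrix}\right)$$ and $\mathrm{Diag}(x)\in\mathbb{R}^{r_b\times r_c}$. Then (P) admits an optimal solution if and only if (V) admits an optimal solution. Furthermore, if $x^*$ is an optimal solution of (V), then $X^*=V_B\,\mathrm{Diag}(x^* )\,U_C^T$ is an optimal solution of (P). Conversely, if $X^*$ is an optimal solution of (P), then $x^*=\mathrm{diag}(V_B^TX^*U_C)$ is an optimal solution of (V).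
   Context: $\sigma(X)$ is the vector of singular values of a matrix $X$ in non-increasing order (of length the minimum of its dimensions). $\mathrm{Diag}(x)$ is the generalized (possibly rectangular, size determined by context) diagonal matrix with diagonal $x$; $\mathrm{diag}(X)$ is the vector of diagonal entries of $X$. $\mathbf 0_{k}$ is the zero vector of length $k$; $\mathbb{R}_+=[0,\infty)$. Thin SVDs: $U_B\in\mathbb{R}^{r\times r_b}$, $V_B\in\mathbb{R}^{m\times r_b}$, $U_C\in\mathbb{R}^{n\times r_c}$, $V_C\in\mathbb{R}^{s\times r_c}$ have orthonormal columns, and $\Sigma_B\in\mathbb{R}^{r_b\times r_b}$, $\Sigma_C\in\mathbb{R}^{r_c\times r_c}$ are diagonal with the positive singular values on the diagonal in non-increasing order. $U_B^\perp\in\mathbb{R}^{r\times(r-r_b)}$ and $V_C^\perp\in\mathbb{R}^{s\times(s-r_c)}$ are orthogonal complements: $[U_B\ U_B^\perp]$ and $[V_C\ V_C^\perp]$ are orthogonal matrices. A function is proper if it never takes the value $-\infty$ and is not identically $+\infty$. A proper $f:\mathbb{R}^q\to(-\infty,\infty]$ is absolutely symmetric if $f(PJx)=f(x)$ for every $x$, every permutation matrix $P$ and every diagonal $J$ with $J_{ii}\in\{\pm1\}$. For $x,y\in\mathbb{R}^q$, $x\prec_w y$ (weak majorization) means $\sum_{i=1}^kx_{[i]}\le\sum_{i=1}^ky_{[i]}$ for $k=1,\dots,q$, where $x_{[1]}\ge\dots\ge x_{[q]}$ are the components in non-increasing order. $f$ is monotone under weak majorization on $\mathbb{R}^q_+$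 if for all $x,y\in\mathbb{R}^q_+$, $x\prec_wy$ implies $f(x)\le f(y)$. A norm on $\mathbb{R}^{r\times s}$ is unitarily invariant if $\|UZV^T\|=\|Z\|$ for all $Z$ and all orthogonal $U,V$. A symmetric gauge function is an absolutely symmetric norm on $\mathbb{R}^{\bar q}$; every unitarily invariant norm is $\phi(\sigma(\cdot))$ for a symmetric gauge function $\phi$. An optimal solution is a feasible point whose objective value is no larger than that of any other feasible point. *)

theory Defs
  imports
    "Jordan_Normal_Form.Char_Poly"
    "Jordan_Normal_Form.DL_Rank"
    "Jordan_Normal_Form.VS_Connect"
    "HOL-Library.Extended_Real"
    "HOL-Combinatorics.Permutations"
begin

text \<open>
  Matrices and vectors are those of \<open>Jordan_Normal_Form\<close>, with explicit dimensions given by the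
  carriers; functions on them matter only on the relevant carrier. Functions with values in
  \<open>(-\<infinity>,\<infinity>]\<close> take values in \<^typ>\<open>ereal\<close> and are required to avoid \<open>-\<infinity>\<close>. Objectives of
  the form \<open>\<mu> * F\<close> with \<open>\<mu> = 0\<close> follow the convention \<open>0 * \<infinity> = 0\<close> of \<^typ>\<open>ereal\<close>.
\<close>

text \<open>
  The square roots of the eigenvalues of \<open>X\<^sup>T X\<close>, counted with algebraic multiplicity, in
  non-increasing order, of which the first \<open>min (dim_row X) (dim_col X)\<close> are kept; if \<open>X\<close> has
  more columns than rows, the entries dropped are zero. All roots are real and nonnegative, so the
  list has exactly \<open>dim_col X\<close> entries and the indexing is in range.
\<close>
definition singular_values :: "real mat \<Rightarrow> real vec" where
  "singular_values X = vec (min (dim_row X) (dim_col X))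
     (\<lambda>i. sqrt (rev (sorted_list_of_multiset (proots (char_poly (X\<^sup>T * X)))) ! i))"

definition Diag_rect :: "nat \<Rightarrow> nat \<Rightarrow> real vec \<Rightarrow> real mat" where
  "Diag_rect nr nc x = mat nr nc (\<lambda>(i, j). if i = j then x $ i else 0)"

definition diag_vec :: "real mat \<Rightarrow> real vec" where
  "diag_vec X = vec (min (dim_row X) (dim_col X)) (\<lambda>i. X $$ (i, i))"

text \<open>
  The name distinguishes this from \<^const>\<open>orthogonal_mat\<close>, which only asks for pairwise orthogonal
  nonzero columns, not normalised ones.
\<close>
definition real_orthogonal_mat :: "nat \<Rightarrow> real mat \<Rightarrow> bool" where
  "real_orthogonal_mat d U \<longleftrightarrow> U \<in> carrier_mat d d \<and> U\<^sup>T * U = 1\<^sub>m d \<and> U * U\<^sup>T = 1\<^sub>m d"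

definition permutation_matrix :: "nat \<Rightarrow> real mat \<Rightarrow> bool" where
  "permutation_matrix d P \<longleftrightarrow>
     (\<exists>\<pi>. \<pi> permutes {..<d} \<and> P = mat d d (\<lambda>(i, j). if j = \<pi> i then 1 else 0))"

definition sign_matrix :: "nat \<Rightarrow> real mat \<Rightarrow> bool" where
  "sign_matrix d J \<longleftrightarrow> J \<in> carrier_mat d d \<and> diagonal_mat J \<and> (\<forall>i<d. J $$ (i, i) \<in> {-1, 1})"

definition absolutely_symmetric :: "nat \<Rightarrow> (real vec \<Rightarrow> 'b) \<Rightarrow> bool" where
  "absolutely_symmetric d f \<longleftrightarrow>
     (\<forall>x\<in>carrier_vec d. \<forall>P J. permutation_matrix d P \<longrightarrow> sign_matrix d J \<longrightarrow>
        f ((P * J) *\<^sub>v x) = f x)"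

definition proper_fun_on :: "'a set \<Rightarrow> ('a \<Rightarrow> ereal) \<Rightarrow> bool" where
  "proper_fun_on S f \<longleftrightarrow> (\<forall>x\<in>S. f x \<noteq> -\<infinity>) \<and> (\<exists>x\<in>S. f x \<noteq> \<infinity>)"

definition weakly_majorized :: "nat \<Rightarrow> real vec \<Rightarrow> real vec \<Rightarrow> bool" where
  "weakly_majorized d x y \<longleftrightarrow>
     (\<forall>k\<in>{1..d}. sum_list (take k (rev (sort (list_of_vec x))))
                 \<le> sum_list (take k (rev (sort (list_of_vec y)))))"

definition nonneg_vecs :: "nat \<Rightarrow> real vec set" where
  "nonneg_vecs d = {x \<in> carrier_vec d. \<forall>i<d. 0 \<le> x $ i}"

definition mono_weak_majorization :: "nat \<Rightarrow> (real vec \<Rightarrow> ereal) \<Rightarrow> bool" where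
  "mono_weak_majorization d f \<longleftrightarrow>
     (\<forall>x\<in>nonneg_vecs d. \<forall>y\<in>nonneg_vecs d. weakly_majorized d x y \<longrightarrow> f x \<le> f y)"

text \<open>The vector space operations are explicit arguments: they are carrier-based for matrices and vectors.\<close>
definition norm_on ::
  "'v set \<Rightarrow> ('v \<Rightarrow> 'v \<Rightarrow> 'v) \<Rightarrow> (real \<Rightarrow> 'v \<Rightarrow> 'v) \<Rightarrow> 'v \<Rightarrow> ('v \<Rightarrow> real) \<Rightarrow> bool" where
  "norm_on V pls scl zr N \<longleftrightarrow>
     (\<forall>x\<in>V. 0 \<le> N x \<and> (N x = 0 \<longleftrightarrow> x = zr)) \<and>
     (\<forall>a. \<forall>x\<in>V. N (scl a x) = \<bar>a\<bar> * N x) \<and>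
     (\<forall>x\<in>V. \<forall>y\<in>V. N (pls x y) \<le> N x + N y)"

definition unitarily_invariant_norm :: "nat \<Rightarrow> nat \<Rightarrow> (real mat \<Rightarrow> real) \<Rightarrow> bool" where
  "unitarily_invariant_norm r s N \<longleftrightarrow>
     norm_on (carrier_mat r s) (+) (\<cdot>\<^sub>m) (0\<^sub>m r s) N \<and>
     (\<forall>Z\<in>carrier_mat r s. \<forall>U V. real_orthogonal_mat r U \<longrightarrow> real_orthogonal_mat s V \<longrightarrow>
        N (U * Z * V\<^sup>T) = N Z)"

definition symmetric_gauge :: "nat \<Rightarrow> (real vec \<Rightarrow> real) \<Rightarrow> bool" where
  "symmetric_gauge d \<phi> \<longleftrightarrow>
     norm_on (carrier_vec d) (+) (\<cdot>\<^sub>v) (0\<^sub>v d) \<phi> \<and> absolutely_symmetric d \<phi>"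

definition orthogonal_projector :: "nat \<Rightarrow> real mat \<Rightarrow> real vec set \<Rightarrow> bool" where
  "orthogonal_projector d P W \<longleftrightarrow> P \<in> carrier_mat d d \<and>
     (\<forall>v\<in>carrier_vec d. P *\<^sub>v v \<in> W \<and> (\<forall>w\<in>W. (v - P *\<^sub>v v) \<bullet> w = 0))"

definition thin_svd :: "real mat \<Rightarrow> real mat \<Rightarrow> real mat \<Rightarrow> real mat \<Rightarrow> bool" where
  "thin_svd M U S V \<longleftrightarrow>
     (let k = vec_space.rank (dim_row M) M in
        U \<in> carrier_mat (dim_row M) k \<and> U\<^sup>T * U = 1\<^sub>m k \<and>
        V \<in> carrier_mat (dim_col M) k \<and> V\<^sup>T * V = 1\<^sub>m k \<and>
        S \<in> carrier_mat k k \<and> diagonal_mat S \<and>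
        (\<forall>i<k. S $$ (i, i) = singular_values M $ i \<and> 0 < S $$ (i, i)) \<and>
        M = U * S * V\<^sup>T)"

definition orthogonal_completion :: "nat \<Rightarrow> real mat \<Rightarrow> real mat \<Rightarrow> bool" where
  "orthogonal_completion d U U' \<longleftrightarrow>
     U' \<in> carrier_mat d (d - dim_col U) \<and> real_orthogonal_mat d (mat_of_cols d (cols U @ cols U'))"

definition optimal_solution :: "'a set \<Rightarrow> ('a \<Rightarrow> ereal) \<Rightarrow> 'a \<Rightarrow> bool" where
  "optimal_solution S obj x \<longleftrightarrow> x \<in> S \<and> (\<forall>y\<in>S. obj x \<le> obj y)"

end

theory Submission
  imports Defs "Jordan_Normal_Form.Schur_Decomposition"
begin

text \<open>
  Why the two problems are equivalent: each feasible point of one yields a feasible point of the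
  other whose objective is no larger, in both directions, by the maps \<open>X \<mapsto> diag_vec (VB\<^sup>T * X * UC)\<close> and
  \<open>x \<mapsto> VB * Diag x * UC\<^sup>T\<close>; optimal solutions then correspond (\<open>optimal_solution_transfer\<close>). The loss
  term and the spectral functions are treated separately.
  
  The loss term. In the orthogonal coordinates adapted to \<open>B\<close> and \<open>C\<close>, the projector identities make
  the residual \<open>A - B * X * C\<close> block diagonal, with a fixed block and the block \<open>At - SB * Y * SC\<close>, where
  \<open>At = UB\<^sup>T * A * VC\<close> and \<open>Y = VB\<^sup>T * X * UC\<close> (\<open>residual_norm_block_form\<close>). Replacing \<open>Y\<close> by its diagonal
  erases the off-diagonal entries of the second block, since \<open>At\<close>, \<open>SB\<close> and \<open>SC\<close> are diagonal. Such a
  pinching is an average of orthogonal sign changes and cannot increase a unitarily invariant norm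
  (\<open>unitarily_invariant_norm_pinch_le\<close>). For \<open>X = VB * Diag x * UC\<^sup>T\<close> the matrix \<open>Y\<close> is already diagonal, and
  the norms agree.
  
  The spectral functions. By monotonicity and symmetry it suffices that the absolute values of the
  diagonal of \<open>VB\<^sup>T * X * UC\<close>, padded by zeros, are weakly majorized by the singular values of \<open>X\<close>, and
  that the singular values of \<open>VB * Diag x * UC\<^sup>T\<close> are weakly majorized by the padded absolute values of
  \<open>x\<close>. Both are instances of one inequality of Ky Fan type (\<open>weakly_majorized_compression\<close>): if \<open>X\<close> has
  an expansion with coefficients \<open>x j\<close> along two orthogonal families, then testing \<open>X\<close> on any two such
  families gives values that a doubly substochastic matrix dominates by \<open>\<bar>x j\<bar>\<close>. The needed singular
  value decomposition comes from the spectral theorem for \<open>X\<^sup>T * X\<close>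
  (\<open>orthogonal_diagonalization\<close>, \<open>singular_value_expansion\<close>).
\<close>

section \<open>The spectral theorem for real symmetric matrices\<close>

lemma index_transpose_mult_mult:
  fixes U M V :: "'a :: comm_semiring_0 mat"
  assumes "U \<in> carrier_mat r k" "M \<in> carrier_mat r s" "V \<in> carrier_mat s l" "i < k" "j < l"
  shows "(U\<^sup>T * M * V) $$ (i, j) = col U i \<bullet> (M *\<^sub>v col V j)"
proof -
  have "U\<^sup>T * M * V = U\<^sup>T * (M * V)"
    using assms by (intro assoc_mult_mat[of _ k r _ s _ l]) auto
  then show ?thesis using assms by (simp add: mult_mat_vec_def)
qed

text \<open>
  Over the complex numbers the characteristic polynomial splits; an eigenvalue \<open>a\<close> with
  eigenvector \<open>v\<close> satisfies \<open>a * (v \<bullet>c v) = cnj a * (v \<bullet>c v)\<close> by symmetry, so all roots are real and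
  the factorization descends to the reals.
\<close>
lemma char_poly_symmetric_splits:
  fixes A :: "real mat"
  assumes A: "A \<in> carrier_mat n n" and sym: "A\<^sup>T = A"
  shows "\<exists>es. char_poly A = (\<Prod>e\<leftarrow>es. [:- e, 1:])"
proof -
  let ?A = "map_mat complex_of_real A"
  have cA: "?A \<in> carrier_mat n n" using A by simp
  have symc: "?A\<^sup>T = ?A" by (metis map_mat_transpose sym)
  obtain as where as: "char_poly ?A = (\<Prod>a\<leftarrow>as. [:- a, 1:])"
    using char_poly_factorized[OF cA] by blast
  have real: "a \<in> \<real>" if "a \<in> set as" for a
  proof -
    have "eigenvalue ?A a"
      using that linear_poly_root[OF that] eigenvalue_root_char_poly[OF cA] as by simp
    then obtain v where v: "v \<in> carrier_vec n" and v0: "v \<noteq> 0\<^sub>v n" and ev: "?A *\<^sub>v v = a \<cdot>\<^sub>v v"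
      using A unfolding eigenvalue_def eigenvector_def by auto
    have cv: "conjugate v \<in> carrier_vec n" using v by simp
    have conj: "?A *\<^sub>v conjugate v = conjugate (?A *\<^sub>v v)"
      using A v by (auto intro!: eq_vecI simp: scalar_prod_def)
    have "a * (v \<bullet>c v) = (?A *\<^sub>v v) \<bullet> conjugate v"
      unfolding ev using v cv by simp
    also have "\<dots> = v \<bullet> (?A *\<^sub>v conjugate v)"
      using transpose_vec_mult_scalar[OF cA v cv] symc cA v cv
      by (metis comm_scalar_prod mult_mat_vec_carrier)
    also have "\<dots> = cnj a * (v \<bullet>c v)"
      unfolding conj ev using v cv by (simp add: conjugate_smult_vec)
    finally have "a = cnj a" using v v0 by simp
    then show ?thesis by (simp add: Reals_cnj_iff)
  qed
  interpret mp: map_poly_inj_comm_ring_hom complex_of_real ..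
  define es where "es = map Re as"
  have as_es: "as = map complex_of_real es"
    unfolding es_def using real by (auto simp: o_def intro!: map_idI[symmetric])
  have "map_poly complex_of_real (char_poly A) = (\<Prod>a\<leftarrow>as. [:- a, 1:])"
    using as of_real_hom.char_poly_hom[OF A, where 'a = complex] by simp
  also have "\<dots> = map_poly complex_of_real (\<Prod>e\<leftarrow>es. [:- e, 1:])"
    unfolding as_es by (induct es) (simp_all add: mp.hom_mult del: mult_pCons_left)
  finally show ?thesis
    by (auto simp: mp.injectivity)
qed

lemma scalar_prod_self_nonneg: "0 \<le> (v :: real vec) \<bullet> v"
  by (simp add: scalar_prod_def sum_nonneg)

lemma scalar_prod_self_eq_0: "v \<in> carrier_vec d \<Longrightarrow> (v :: real vec) \<bullet> v = 0 \<longleftrightarrow> v = 0\<^sub>v d"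
  by (metis conjugate_square_eq_0_vec conjugate_real_def conjugate_vec_def vec_conjugate_real)

text \<open>
  Complete \<open>v\<close> to a basis, apply Gram-Schmidt (which keeps the first vector), and normalise.
\<close>
lemma orthonormal_basis_extending_direction:
  fixes v :: "real vec"
  assumes v: "v \<in> carrier_vec n" and v0: "v \<noteq> 0\<^sub>v n"
  shows "\<exists>W c. W \<in> carrier_mat n n \<and> W\<^sup>T * W = 1\<^sub>m n \<and> col W 0 = c \<cdot>\<^sub>v v"
proof -
  interpret cof_vec_space n "TYPE(real)" .
  define b where "b = basis_completion v"
  define ws where "ws = gram_schmidt n b"
  note bc = basis_completion[OF v v0, folded b_def]
  note gs = gram_schmidt_result[OF bc(2) bc(4) bc(5) ws_def]
  have len: "length ws = n" using gs(4) bc(6) by simp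
  have "n \<noteq> 0" using v v0 by (auto intro: eq_vecI)
  then obtain vs where "b = v # vs" using bc(6,7) by (cases b) auto
  then have "hd ws = v" unfolding ws_def using v by simp
  then have hd: "ws ! 0 = v" using len \<open>n \<noteq> 0\<close> by (metis hd_conv_nth list.size(3))
  have wc: "ws ! i \<in> carrier_vec n" if "i < n" for i
    using gs(3) len that by (meson nth_mem subsetD)
  have orth: "(ws ! i \<bullet> ws ! j = 0) = (i \<noteq> j)" if "i < n" "j < n" for i j
    using corthogonalD[OF gs(2), of i j] len that by (simp add: vec_conjugate_real)
  define s where "s = (\<lambda>i. 1 / sqrt (ws ! i \<bullet> ws ! i))"
  define W where "W = mat_of_cols n (map (\<lambda>i. s i \<cdot>\<^sub>v ws ! i) [0..<n])"
  have W: "W \<in> carrier_mat n n" unfolding W_def by (simp add: mat_of_cols_def)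
  have col: "col W i = s i \<cdot>\<^sub>v ws ! i" if "i < n" for i
    unfolding W_def using that wc by (subst col_mat_of_cols) auto
  have "W\<^sup>T * W = 1\<^sub>m n"
  proof (rule eq_matI)
    fix i j assume "i < dim_row (1\<^sub>m n :: real mat)" "j < dim_col (1\<^sub>m n :: real mat)"
    then have ij: "i < n" "j < n" by auto
    have "(W\<^sup>T * W) $$ (i, j) = s i * (s j * (ws ! i \<bullet> ws ! j))"
      using ij W wc[OF ij(1)] wc[OF ij(2)] by (simp add: col)
    also have "\<dots> = (if i = j then 1 else 0)"
    proof (cases "i = j")
      case True
      have "ws ! j \<bullet> ws ! j > 0"
        using orth[of j j] ij scalar_prod_self_nonneg[of "ws ! j"] by force
      then show ?thesis using True by (simp add: s_def)
    qed (use orth ij in auto)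
    finally show "(W\<^sup>T * W) $$ (i, j) = 1\<^sub>m n $$ (i, j)" using ij by simp
  qed (use W in auto)
  moreover have "col W 0 = s 0 \<cdot>\<^sub>v v" using col[of 0] \<open>n \<noteq> 0\<close> hd by simp
  ultimately show ?thesis using W by blast
qed

text \<open>
  The spectral theorem with the order of the eigenvalues prescribed: any listing \<open>es\<close> of the roots of
  the characteristic polynomial can be realised on the diagonal. This freedom is what later makes the
  diagonal agree with the non-increasing order of the singular values. The proof deflates one
  eigenvector at a time: conjugating by an orthogonal matrix whose first column is an eigenvector
  for \<open>e\<close> splits off a \<open>1 \<times> 1\<close> block, because by symmetry the first row vanishes together with the
  first column.
\<close>
lemma orthogonal_diagonalization:
  fixes A :: "real mat"
  assumes "A \<in> carrier_mat n n" "A\<^sup>T = A" "char_poly A = (\<Prod>e\<leftarrow>es. [:- e, 1:])"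
  shows "\<exists>W. W \<in> carrier_mat n n \<and> W\<^sup>T * W = 1\<^sub>m n \<and>
    W\<^sup>T * A * W = mat n n (\<lambda>(i, j). if i = j then es ! i else 0)"
  using assms
proof (induction es arbitrary: n A)
  case Nil
  then have "n = 0" using degree_monic_char_poly[of A n] by auto
  then show ?case using Nil by (intro exI[of _ "1\<^sub>m 0"]) (auto intro!: eq_matI)
next
  case (Cons e es)
  note A = Cons.prems(1) and sym = Cons.prems(2)
  have "n \<noteq> 0"
  proof
    assume "n = 0"
    then have "poly (char_poly A) e = 1"
      using A degree_monic_char_poly[OF A] by (auto elim!: degree_eq_zeroE)
    then show False unfolding Cons.prems(3) by simp
  qed
  then obtain k where n: "n = Suc k" using not0_implies_Suc by blast
  have "eigenvalue A e" unfolding eigenvalue_root_char_poly[OF A] Cons.prems(3) by simp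
  then obtain v where v: "v \<in> carrier_vec n" and v0: "v \<noteq> 0\<^sub>v n" and ev: "A *\<^sub>v v = e \<cdot>\<^sub>v v"
    using A unfolding eigenvalue_def eigenvector_def by auto
  obtain W c where W: "W \<in> carrier_mat n n" and WW: "W\<^sup>T * W = 1\<^sub>m n" and W0: "col W 0 = c \<cdot>\<^sub>v v"
    using orthonormal_basis_extending_direction[OF v v0] by blast
  have WW': "W * W\<^sup>T = 1\<^sub>m n" using mat_mult_left_right_inverse[of "W\<^sup>T" n W] W WW by auto
  define M where "M = W\<^sup>T * A * W"
  have M: "M \<in> carrier_mat n n" unfolding M_def using W A by auto
  have Msym: "M\<^sup>T = M"
    unfolding M_def using W A sym
    by (simp add: transpose_mult[of _ n n _ n] assoc_mult_mat[of _ n n _ n _ n])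
  have "A *\<^sub>v col W 0 = e \<cdot>\<^sub>v col W 0"
    unfolding W0 using A v ev by (simp add: mult_mat_vec smult_smult_assoc mult.commute)
  then have M0: "M $$ (i, 0) = (if i = 0 then e else 0)" if "i < n" for i
  proof -
    have "M $$ (i, 0) = col W i \<bullet> (A *\<^sub>v col W 0)"
      unfolding M_def using that n A W by (intro index_transpose_mult_mult[of W n n A n W n]) auto
    also have "\<dots> = e * (col W i \<bullet> col W 0)" using \<open>A *\<^sub>v col W 0 = _\<close> W n that by simp
    also have "col W i \<bullet> col W 0 = (W\<^sup>T * W) $$ (i, 0)" using W n that by simp
    finally show ?thesis unfolding WW using that n by simp
  qed
  have M0': "M $$ (0, i) = (if i = 0 then e else 0)" if "i < n" for i
    using M0[OF that] arg_cong[OF Msym, of "\<lambda>X. X $$ (i, 0)"] M n that by simp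
  define R where "R = mat k k (\<lambda>(i, j). M $$ (Suc i, Suc j))"
  have R: "R \<in> carrier_mat k k" unfolding R_def by simp
  have E: "mat 1 1 (\<lambda>_. e) \<in> carrier_mat 1 1" by simp
  have Mblock: "M = four_block_mat (mat 1 1 (\<lambda>_. e)) (0\<^sub>m 1 k) (0\<^sub>m k 1) R"
    using M n M0 M0' by (intro eq_matI) (auto simp: R_def)
  have Rsym: "R\<^sup>T = R"
  proof (rule eq_matI)
    fix i j assume "i < dim_row R" "j < dim_col R"
    then show "R\<^sup>T $$ (i, j) = R $$ (i, j)"
      using arg_cong[OF Msym, of "\<lambda>X. X $$ (Suc i, Suc j)"] M n by (simp add: R_def)
  qed (auto simp: R_def)
  have "similar_mat M A"
    unfolding similar_mat_def similar_mat_wit_def M_def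
    using A W WW WW' by (intro exI[of _ "W\<^sup>T"] exI[of _ W]) (auto simp: Let_def)
  then have "char_poly A = char_poly M" by (rule char_poly_similar[symmetric])
  also have "\<dots> = char_poly (mat 1 1 (\<lambda>_. e)) * char_poly R"
    unfolding Mblock by (rule char_poly_four_block_zeros_col[OF E zero_carrier_mat R])
  also have "char_poly (mat 1 1 (\<lambda>_. e)) = [:- e, 1:]"
    by (simp add: char_poly_defs det_def sign_def)
  finally have "[:- e, 1:] * char_poly R = char_poly A" by simp
  then have cR: "char_poly R = (\<Prod>e\<leftarrow>es. [:- e, 1:])"
    unfolding Cons.prems(3) list.map prod_list.Cons
    by (subst (asm) mult_cancel_left) simp
  obtain V where V: "V \<in> carrier_mat k k" and VV: "V\<^sup>T * V = 1\<^sub>m k"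
    and VRV: "V\<^sup>T * R * V = mat k k (\<lambda>(i, j). if i = j then es ! i else 0)"
    using Cons.IH[OF R Rsym cR] by blast
  define Q where "Q = four_block_mat (1\<^sub>m 1) (0\<^sub>m 1 k) (0\<^sub>m k 1) V"
  have Q: "Q \<in> carrier_mat n n" unfolding Q_def n using V by (auto simp del: four_block_mat_def)
  have QT: "Q\<^sup>T = four_block_mat (1\<^sub>m 1) (0\<^sub>m 1 k) (0\<^sub>m k 1) V\<^sup>T"
    unfolding Q_def using V by (subst transpose_four_block_mat[of _ 1 1 _ k _ k]) auto
  have QQ: "Q\<^sup>T * Q = 1\<^sub>m n"
    unfolding QT unfolding Q_def using V VV n
    by (subst mult_four_block_mat[of _ 1 1 _ k _ k _ _ 1 _ k]) auto
  have QM: "Q\<^sup>T * M = four_block_mat (mat 1 1 (\<lambda>_. e)) (0\<^sub>m 1 k) (0\<^sub>m k 1) (V\<^sup>T * R)"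
    unfolding QT Mblock using V R
    by (subst mult_four_block_mat[of _ 1 1 _ k _ k _ _ 1 _ k]) auto
  have "Q\<^sup>T * M * Q = four_block_mat (mat 1 1 (\<lambda>_. e)) (0\<^sub>m 1 k) (0\<^sub>m k 1) (V\<^sup>T * R * V)"
    unfolding QM unfolding Q_def using V R
    by (subst mult_four_block_mat[of _ 1 1 _ k _ k _ _ 1 _ k]) auto
  also have "\<dots> = mat n n (\<lambda>(i, j). if i = j then (e # es) ! i else 0)"
    unfolding VRV n by (intro eq_matI) (auto simp: nth_Cons')
  finally have QMQ: "Q\<^sup>T * M * Q = mat n n (\<lambda>(i, j). if i = j then (e # es) ! i else 0)" .
  show ?case
  proof (intro exI[of _ "W * Q"] conjI)
    show "W * Q \<in> carrier_mat n n" using W Q by auto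
    have t: "(W * Q)\<^sup>T = Q\<^sup>T * W\<^sup>T" using W Q by (simp add: transpose_mult)
    have "(W * Q)\<^sup>T * (W * Q) = Q\<^sup>T * (W\<^sup>T * W) * Q"
      unfolding t using W Q by (simp add: assoc_mult_mat[of _ n n _ n _ n])
    then show "(W * Q)\<^sup>T * (W * Q) = 1\<^sub>m n" unfolding WW using Q QQ by simp
    have "(W * Q)\<^sup>T * A * (W * Q) = Q\<^sup>T * M * Q"
      unfolding t M_def using W Q A by (simp add: assoc_mult_mat[of _ n n _ n _ n])
    then show "(W * Q)\<^sup>T * A * (W * Q) = mat n n (\<lambda>(i, j). if i = j then (e # es) ! i else 0)"
      unfolding QMQ .
  qed
qed

section \<open>Weak majorization by doubly substochastic matrices\<close>

text \<open>
  The sums of the \<open>k\<close> largest entries in the definition of weak majorization, written with a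
  permutation of the indices instead of a sorted list.
\<close>
lemma decreasing_rearrangement:
  assumes x: "x \<in> carrier_vec d"
  shows "\<exists>\<pi>. \<pi> permutes {..<d} \<and>
    (\<forall>k\<le>d. sum_list (take k (rev (sort (list_of_vec x)))) = (\<Sum>i<k. x $ \<pi> i)) \<and>
    (\<forall>i j. i \<le> j \<longrightarrow> j < d \<longrightarrow> x $ \<pi> j \<le> x $ \<pi> i)"
proof -
  let ?l = "list_of_vec x" and ?s = "rev (sort (list_of_vec x))"
  have len: "length ?l = d" using x by simp
  have "mset ?s = mset ?l" by simp
  then obtain \<pi> where \<pi>: "\<pi> permutes {..<length ?l}" and perm: "permute_list \<pi> ?l = ?s"
    by (rule mset_eq_permutation)
  have nth: "?s ! i = x $ \<pi> i" if "i < d" for i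
    using permute_list_nth[OF \<pi>, of i] perm that permutes_in_image[OF \<pi>, of i] x by simp
  show ?thesis
  proof (intro exI[of _ \<pi>] conjI allI impI)
    show "\<pi> permutes {..<d}" using \<pi> len by simp
    show "sum_list (take k ?s) = (\<Sum>i<k. x $ \<pi> i)" if "k \<le> d" for k
      using that len nth by (subst sum_list_sum_nth) (auto simp: min_def atLeast0LessThan intro!: sum.cong)
    show "x $ \<pi> j \<le> x $ \<pi> i" if "i \<le> j" "j < d" for i j
    proof -
      have "sorted_wrt (\<ge>) ?s" by (simp add: sorted_wrt_rev)
      then show ?thesis
        using sorted_wrt_nth_less[of "(\<ge>)" ?s i j] that nth len by (cases "i = j") auto
    qed
  qed
qed

text \<open>
  Weights in \<open>[0, 1]\<close> of total at most \<open>k\<close> do best on the \<open>k\<close> largest values. Compare every term with the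
  threshold \<open>\<theta> = z (k - 1)\<close>: taking weight away from the first \<open>k\<close> indices costs at least \<open>\<theta>\<close> per unit,
  and a unit placed on a later index earns at most \<open>\<theta>\<close>.
\<close>
lemma weighted_sum_le_initial_sum:
  fixes s z :: "nat \<Rightarrow> real"
  assumes "k \<le> d" and s: "\<And>j. j < d \<Longrightarrow> 0 \<le> s j" "\<And>j. j < d \<Longrightarrow> s j \<le> 1"
    and sum: "(\<Sum>j<d. s j) \<le> real k"
    and z: "\<And>j. j < d \<Longrightarrow> 0 \<le> z j" and dec: "\<And>i j. i \<le> j \<Longrightarrow> j < d \<Longrightarrow> z j \<le> z i"
  shows "(\<Sum>j<d. s j * z j) \<le> (\<Sum>j<k. z j)"
proof (cases "k = 0")
  case True
  then have "(\<Sum>j<d. s j) = 0" using sum s(1) by (intro antisym sum_nonneg) auto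
  then have "\<forall>j\<in>{..<d}. s j = 0" by (subst sum_nonneg_eq_0_iff[symmetric]) (use s in auto)
  then show ?thesis using True by simp
next
  case False
  define \<theta> where "\<theta> = z (k - 1)"
  let ?h = "\<lambda>j. if j < k then 1 else 0 :: real"
  have h: "(\<Sum>j<d. ?h j * g j) = (\<Sum>j<k. g j)" for g
    using \<open>k \<le> d\<close> by (intro sum.mono_neutral_cong_right) auto
  have "(\<Sum>j<d. (s j - ?h j) * z j) \<le> (\<Sum>j<d. (s j - ?h j) * \<theta>)"
  proof (rule sum_mono)
    fix j assume "j \<in> {..<d}"
    then have j: "j < d" by simp
    show "(s j - ?h j) * z j \<le> (s j - ?h j) * \<theta>"
    proof (cases "j < k")
      case True
      then have "\<theta> \<le> z j" unfolding \<theta>_def using \<open>k \<le> d\<close> by (intro dec) auto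
      then show ?thesis using True s(2)[OF j] by (intro mult_left_mono_neg) auto
    next
      case False
      then have "z j \<le> \<theta>" unfolding \<theta>_def using j by (intro dec) auto
      then show ?thesis using False s(1)[OF j] by (intro mult_left_mono) auto
    qed
  qed
  also have "\<dots> = ((\<Sum>j<d. s j) - real k) * \<theta>"
    using h[of "\<lambda>_. 1"] by (simp add: sum_distrib_right[symmetric] sum_subtractf)
  also have "\<dots> \<le> 0"
    using sum z[of "k - 1"] False \<open>k \<le> d\<close> unfolding \<theta>_def by (intro mult_nonpos_nonneg) auto
  finally show ?thesis
    using h[of z] by (simp add: left_diff_distrib sum_subtractf)
qed

text \<open>
  Summing the hypothesis over any \<open>k\<close> rows gives the entries of \<open>x\<close> the column weights \<open>t\<close>, which lie in
  \<open>[0, 1]\<close> by the column sums and have total at most \<open>k\<close> by the row sums.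
\<close>
lemma weakly_majorized_of_doubly_substochastic:
  assumes x: "x \<in> nonneg_vecs d" and y: "y \<in> carrier_vec d"
    and c: "\<And>i j. i < d \<Longrightarrow> j < d \<Longrightarrow> (0 :: real) \<le> c i j"
    and rows: "\<And>i. i < d \<Longrightarrow> (\<Sum>j<d. c i j) \<le> 1"
    and cols: "\<And>j. j < d \<Longrightarrow> (\<Sum>i<d. c i j) \<le> 1"
    and yx: "\<And>i. i < d \<Longrightarrow> y $ i \<le> (\<Sum>j<d. c i j * x $ j)"
  shows "weakly_majorized d y x"
proof -
  have xc: "x \<in> carrier_vec d" and x0: "\<And>i. i < d \<Longrightarrow> 0 \<le> x $ i"
    using x by (auto simp: nonneg_vecs_def)
  obtain \<pi> where \<pi>: "\<pi> permutes {..<d}"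
    and xs: "\<And>k. k \<le> d \<Longrightarrow> sum_list (take k (rev (sort (list_of_vec x)))) = (\<Sum>i<k. x $ \<pi> i)"
    and dec: "\<And>i j. i \<le> j \<Longrightarrow> j < d \<Longrightarrow> x $ \<pi> j \<le> x $ \<pi> i"
    using decreasing_rearrangement[OF xc] by metis
  obtain \<rho> where \<rho>: "\<rho> permutes {..<d}"
    and ys: "\<And>k. k \<le> d \<Longrightarrow> sum_list (take k (rev (sort (list_of_vec y)))) = (\<Sum>i<k. y $ \<rho> i)"
    using decreasing_rearrangement[OF y] by metis
  have \<pi>d: "\<pi> i < d" if "i < d" for i using permutes_in_image[OF \<pi>, of i] that by simp
  have \<rho>d: "\<rho> i < d" if "i < d" for i using permutes_in_image[OF \<rho>, of i] that by simp
  show ?thesis unfolding weakly_majorized_def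
  proof
    fix k assume "k \<in> {1..d}"
    then have k: "k \<le> d" by simp
    define t where "t = (\<lambda>j. \<Sum>i<k. c (\<rho> i) j)"
    have t0: "0 \<le> t j" if "j < d" for j
      unfolding t_def using k that \<rho>d by (intro sum_nonneg c) auto
    have t1: "t j \<le> 1" if "j < d" for j
    proof -
      have "t j \<le> (\<Sum>i<d. c (\<rho> i) j)"
        unfolding t_def using k that \<rho>d by (intro sum_mono2 c) auto
      also have "\<dots> = (\<Sum>i<d. c i j)"
        using sum.permute[OF \<rho>, of "\<lambda>i. c i j"] by (simp add: o_def)
      finally show ?thesis using cols[OF that] by simp
    qed
    have tsum: "(\<Sum>j<d. t (\<pi> j)) \<le> real k"
    proof -
      have "(\<Sum>j<d. t (\<pi> j)) = (\<Sum>j<d. t j)"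
        using sum.permute[OF \<pi>, of t] by (simp add: o_def)
      also have "\<dots> = (\<Sum>i<k. \<Sum>j<d. c (\<rho> i) j)" unfolding t_def by (rule sum.swap)
      also have "\<dots> \<le> (\<Sum>i<k. 1)" using k \<rho>d by (intro sum_mono rows) auto
      finally show ?thesis by simp
    qed
    have "(\<Sum>i<k. y $ \<rho> i) \<le> (\<Sum>i<k. \<Sum>j<d. c (\<rho> i) j * x $ j)"
      using k \<rho>d by (intro sum_mono yx) auto
    also have "\<dots> = (\<Sum>j<d. t j * x $ j)"
      unfolding t_def sum_distrib_right by (rule sum.swap)
    also have "\<dots> = (\<Sum>j<d. t (\<pi> j) * x $ \<pi> j)"
      using sum.permute[OF \<pi>, of "\<lambda>j. t j * x $ j"] by (simp add: o_def)
    also have "\<dots> \<le> (\<Sum>j<k. x $ \<pi> j)"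
      using k t0 t1 \<pi>d x0 dec tsum by (intro weighted_sum_le_initial_sum) auto
    finally show "sum_list (take k (rev (sort (list_of_vec y)))) \<le>
        sum_list (take k (rev (sort (list_of_vec x))))"
      using xs ys k by simp
  qed
qed

text \<open>
  Allowing vectors shorter than a unit vector, in particular zero, makes it possible to pad a family to a prescribed length and to normalise vectors some of which
  vanish, while Bessel's inequality survives.
\<close>
definition suborthonormal :: "nat \<Rightarrow> nat \<Rightarrow> (nat \<Rightarrow> real vec) \<Rightarrow> bool" where
  "suborthonormal d q a \<longleftrightarrow>
     (\<forall>i<q. a i \<in> carrier_vec d \<and> a i \<bullet> a i \<le> 1) \<and>
     (\<forall>i<q. \<forall>j<q. i \<noteq> j \<longrightarrow> a i \<bullet> a j = 0)"

lemma suborthonormal_subset: "suborthonormal d q a \<Longrightarrow> k \<le> q \<Longrightarrow> suborthonormal d k a"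
  by (auto simp: suborthonormal_def)

lemma scalar_prod_lincomb:
  fixes u :: "real vec"
  assumes "u \<in> carrier_vec d" "\<And>i. i < q \<Longrightarrow> a i \<in> carrier_vec d"
  shows "u \<bullet> vec d (\<lambda>k. \<Sum>i<q. c i * a i $ k) = (\<Sum>i<q. c i * (u \<bullet> a i))"
proof -
  have "u \<bullet> vec d (\<lambda>k. \<Sum>i<q. c i * a i $ k) = (\<Sum>k<d. \<Sum>i<q. c i * (u $ k * a i $ k))"
    by (simp add: scalar_prod_def sum_distrib_left atLeast0LessThan mult.left_commute)
  also have "\<dots> = (\<Sum>i<q. \<Sum>k<d. c i * (u $ k * a i $ k))" by (rule sum.swap)
  also have "\<dots> = (\<Sum>i<q. c i * (u \<bullet> a i))"
  proof (rule sum.cong)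
    fix i assume "i \<in> {..<q}"
    then have "dim_vec (a i) = d" using assms(2) by auto
    then show "(\<Sum>k<d. c i * (u $ k * a i $ k)) = c i * (u \<bullet> a i)"
      by (simp add: scalar_prod_def sum_distrib_left atLeast0LessThan)
  qed simp
  finally show ?thesis .
qed

text \<open>
  With \<open>w = \<Sum>i. (a i \<bullet> v) a i\<close> one has \<open>v \<bullet> w = \<Sum>i. (a i \<bullet> v)\<^sup>2\<close>, while \<open>w \<bullet> w\<close> is at most that sum since
  \<open>a i \<bullet> a i \<le> 1\<close>. Expand \<open>0 \<le> (v - w) \<bullet> (v - w)\<close>.
\<close>
lemma bessel_inequality:
  assumes a: "suborthonormal d q a" and v: "v \<in> carrier_vec d"
  shows "(\<Sum>i<q. (a i \<bullet> v)\<^sup>2) \<le> v \<bullet> v"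
proof -
  have ac: "a i \<in> carrier_vec d" if "i < q" for i using a that by (auto simp: suborthonormal_def)
  define c where "c = (\<lambda>i. a i \<bullet> v)"
  define w where "w = vec d (\<lambda>k. \<Sum>i<q. c i * a i $ k)"
  have w: "w \<in> carrier_vec d" unfolding w_def by simp
  have vw: "u \<bullet> w = (\<Sum>i<q. c i * (u \<bullet> a i))" if "u \<in> carrier_vec d" for u
    unfolding w_def using that ac by (rule scalar_prod_lincomb)
  have "v \<bullet> w = (\<Sum>i<q. (c i)\<^sup>2)"
    unfolding vw[OF v] c_def using ac v
    by (intro sum.cong) (auto simp: power2_eq_square comm_scalar_prod[of v d])
  moreover have "w \<bullet> a i = c i * (a i \<bullet> a i)" if "i < q" for i
  proof -
    have "w \<bullet> a i = a i \<bullet> w" using w ac that by (metis comm_scalar_prod)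
    also have "\<dots> = (\<Sum>j<q. c j * (a i \<bullet> a j))" using vw ac that by simp
    also have "\<dots> = (\<Sum>j<q. if j = i then c i * (a i \<bullet> a i) else 0)"
      using a that by (intro sum.cong) (auto simp: suborthonormal_def)
    finally show ?thesis using that by simp
  qed
  then have "w \<bullet> w = (\<Sum>i<q. (c i)\<^sup>2 * (a i \<bullet> a i))"
    unfolding vw[OF w] by (intro sum.cong) (auto simp: power2_eq_square)
  moreover have "\<dots> \<le> (\<Sum>i<q. (c i)\<^sup>2)"
    using a by (intro sum_mono mult_left_le) (auto simp: suborthonormal_def)
  moreover have "(v - w) \<bullet> (v - w) = v \<bullet> v - 2 * (v \<bullet> w) + w \<bullet> w"
    using v w by (simp add: minus_scalar_prod_distrib scalar_prod_minus_distrib comm_scalar_prod[of w d v])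
  moreover have "0 \<le> (v - w) \<bullet> (v - w)" by (rule scalar_prod_self_nonneg)
  ultimately show ?thesis unfolding c_def by linarith
qed

text \<open>
  Sum Bessel's inequality over the unit vectors. In particular at most \<open>d\<close> orthonormal vectors exist
  in dimension \<open>d\<close>, so a Gram matrix \<open>X\<^sup>T * X\<close> has at most as many nonzero eigenvalues as \<open>X\<close> has
  rows.
\<close>
lemma suborthonormal_norms_le_dim:
  assumes a: "suborthonormal d q a"
  shows "(\<Sum>i<q. a i \<bullet> a i) \<le> real d"
proof -
  have ac: "a i \<in> carrier_vec d" if "i < q" for i using a that by (auto simp: suborthonormal_def)
  have "(\<Sum>i<q. a i \<bullet> a i) = (\<Sum>i<q. \<Sum>k<d. (a i \<bullet> unit_vec d k)\<^sup>2)"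
  proof (rule sum.cong)
    fix i assume "i \<in> {..<q}"
    then have "dim_vec (a i) = d" using ac by auto
    then show "a i \<bullet> a i = (\<Sum>k<d. (a i \<bullet> unit_vec d k)\<^sup>2)"
      by (simp add: scalar_prod_def[of "a i" "a i"] atLeast0LessThan power2_eq_square)
  qed simp
  also have "\<dots> = (\<Sum>k<d. \<Sum>i<q. (a i \<bullet> unit_vec d k)\<^sup>2)" by (rule sum.swap)
  also have "\<dots> \<le> (\<Sum>k<d. unit_vec d k \<bullet> (unit_vec d k :: real vec))"
    using a by (intro sum_mono bessel_inequality) auto
  also have "\<dots> = real d" by simp
  finally show ?thesis .
qed

text \<open>
  The decomposition \<open>X = (\<Sum>j<q. x j * a j * (b j)\<^sup>T)\<close>, tested against pairs of vectors. Both a singular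
  value decomposition and \<open>V * Diag x * U\<^sup>T\<close> with orthonormal columns are of this form; the
  coefficients \<open>x j\<close> may be negative and unsorted.
\<close>
definition bilinear_expansion ::
    "nat \<Rightarrow> nat \<Rightarrow> nat \<Rightarrow> real mat \<Rightarrow> (nat \<Rightarrow> real) \<Rightarrow> (nat \<Rightarrow> real vec) \<Rightarrow> (nat \<Rightarrow> real vec) \<Rightarrow> bool" where
  "bilinear_expansion m n q X x a b \<longleftrightarrow>
     suborthonormal m q a \<and> suborthonormal n q b \<and>
     (\<forall>u\<in>carrier_vec m. \<forall>w\<in>carrier_vec n.
        u \<bullet> (X *\<^sub>v w) = (\<Sum>j<q. x j * ((a j \<bullet> u) * (b j \<bullet> w))))"

lemma sum_abs_mult_le_1:
  fixes f g :: "nat \<Rightarrow> real"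
  assumes "(\<Sum>i<q. (f i)\<^sup>2) \<le> 1" "(\<Sum>i<q. (g i)\<^sup>2) \<le> 1"
  shows "(\<Sum>i<q. \<bar>f i * g i\<bar>) \<le> 1"
proof -
  have "2 * \<bar>f i * g i\<bar> \<le> (f i)\<^sup>2 + (g i)\<^sup>2" for i
    using sum_squares_bound[of "\<bar>f i\<bar>" "\<bar>g i\<bar>"] by (simp add: abs_mult)
  then have "(\<Sum>i<q. 2 * \<bar>f i * g i\<bar>) \<le> (\<Sum>i<q. (f i)\<^sup>2 + (g i)\<^sup>2)" by (rule sum_mono)
  then show ?thesis using assms by (simp add: sum.distrib sum_distrib_left[symmetric])
qed

text \<open>
  The Ky Fan type inequality behind both comparisons of spectral functions. The coefficients
  \<open>\<bar>(a j \<bullet> u i) * (b j \<bullet> w i)\<bar>\<close> in the expansion of \<open>u i \<bullet> (X *\<^sub>v w i)\<close> form a doubly substochastic matrix: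
  by the arithmetic-geometric mean inequality, rows are controlled by Bessel for \<open>a\<close>, \<open>b\<close> and columns
  by Bessel for \<open>u\<close>, \<open>w\<close>.
\<close>
lemma weakly_majorized_compression:
  assumes X: "bilinear_expansion m n q X x a b"
    and u: "suborthonormal m q u" and w: "suborthonormal n q w"
  shows "weakly_majorized q (vec q (\<lambda>i. \<bar>u i \<bullet> (X *\<^sub>v w i)\<bar>)) (vec q (\<lambda>j. \<bar>x j\<bar>))"
proof (rule weakly_majorized_of_doubly_substochastic)
  note a = X[unfolded bilinear_expansion_def, THEN conjunct1]
  note b = X[unfolded bilinear_expansion_def, THEN conjunct2, THEN conjunct1]
  let ?c = "\<lambda>i j. \<bar>(a j \<bullet> u i) * (b j \<bullet> w i)\<bar>"
  note so = a b u w
  have car: "a i \<in> carrier_vec m" "u i \<in> carrier_vec m" "b i \<in> carrier_vec n" "w i \<in> carrier_vec n"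
    and le: "a i \<bullet> a i \<le> 1" "u i \<bullet> u i \<le> 1" "b i \<bullet> b i \<le> 1" "w i \<bullet> w i \<le> 1" if "i < q" for i
    using so that by (auto simp: suborthonormal_def)
  show "(\<Sum>j<q. ?c i j) \<le> 1" if "i < q" for i
    using bessel_inequality[OF a car(2)[OF that]] bessel_inequality[OF b car(4)[OF that]] le[OF that]
    by (intro sum_abs_mult_le_1) linarith+
  show "(\<Sum>i<q. ?c i j) \<le> 1" if "j < q" for j
  proof -
    have "(\<Sum>i<q. ?c i j) = (\<Sum>i<q. \<bar>(u i \<bullet> a j) * (w i \<bullet> b j)\<bar>)"
      using car that by (intro sum.cong) (auto simp: comm_scalar_prod[of "a j" m] comm_scalar_prod[of "b j" n])
    also have "\<dots> \<le> 1"
      using bessel_inequality[OF u car(1)[OF that]] bessel_inequality[OF w car(3)[OF that]] le[OF that]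
      by (intro sum_abs_mult_le_1) linarith+
    finally show ?thesis .
  qed
  show "vec q (\<lambda>i. \<bar>u i \<bullet> (X *\<^sub>v w i)\<bar>) $ i \<le> (\<Sum>j<q. ?c i j * vec q (\<lambda>j. \<bar>x j\<bar>) $ j)" if "i < q" for i
  proof -
    have "u i \<bullet> (X *\<^sub>v w i) = (\<Sum>j<q. x j * ((a j \<bullet> u i) * (b j \<bullet> w i)))"
      using X car[OF that] by (simp add: bilinear_expansion_def)
    also have "\<bar>\<dots>\<bar> \<le> (\<Sum>j<q. \<bar>x j * ((a j \<bullet> u i) * (b j \<bullet> w i))\<bar>)" by (rule sum_abs)
    also have "\<dots> = (\<Sum>j<q. ?c i j * vec q (\<lambda>j. \<bar>x j\<bar>) $ j)"
      by (intro sum.cong) (auto simp: abs_mult)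
    finally show ?thesis using that by simp
  qed
qed (auto simp: nonneg_vecs_def)

section \<open>Singular value decomposition\<close>

lemma symmetric_orthonormal_eigenbasis:
  fixes A :: "real mat"
  assumes A: "A \<in> carrier_mat n n" and sym: "A\<^sup>T = A"
  defines "es \<equiv> rev (sorted_list_of_multiset (proots (char_poly A)))"
  shows "length es = n"
    and "\<exists>W. W \<in> carrier_mat n n \<and> W\<^sup>T * W = 1\<^sub>m n \<and>
      W\<^sup>T * A * W = mat n n (\<lambda>(i, j). if i = j then es ! i else 0)"
proof -
  obtain ds where ds: "char_poly A = (\<Prod>e\<leftarrow>ds. [:- e, 1:])"
    using char_poly_symmetric_splits[OF A sym] by blast
  have "proots (\<Prod>e\<leftarrow>xs. [:- e, 1:]) = mset xs" for xs :: "real list"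
  proof (induction xs)
    case (Cons e xs)
    have "(\<Prod>e\<leftarrow>xs. [:- e, 1:]) \<noteq> 0" by (auto simp: prod_list_zero_iff)
    then have "proots ([:- e, 1:] * (\<Prod>e\<leftarrow>xs. [:- e, 1:])) = {#e#} + mset xs"
      using Cons by (subst proots_mult) auto
    then show ?case by simp
  qed simp
  then have es: "mset es = mset ds" unfolding es_def ds by simp
  \<comment> \<open>The diagonalization accepts the roots in any order, in particular in the sorted one.\<close>
  have "char_poly A = (\<Prod>e\<leftarrow>es. [:- e, 1:])"
    unfolding ds using es by (metis mset_map prod_mset_prod_list)
  then show "\<exists>W. W \<in> carrier_mat n n \<and> W\<^sup>T * W = 1\<^sub>m n \<and>
      W\<^sup>T * A * W = mat n n (\<lambda>(i, j). if i = j then es ! i else 0)"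
    by (rule orthogonal_diagonalization[OF A sym])
  have "degree (\<Prod>e\<leftarrow>xs. [:- e, 1:]) = length xs" for xs :: "real list"
  proof (induction xs)
    case (Cons e xs)
    have "(\<Prod>e\<leftarrow>xs. [:- e, 1:]) \<noteq> 0" by (auto simp: prod_list_zero_iff)
    then have "degree ([:- e, 1:] * (\<Prod>e\<leftarrow>xs. [:- e, 1:])) = 1 + length xs"
      using Cons by (subst degree_mult_eq) auto
    then show ?case by simp
  qed simp
  then have "length ds = n" using degree_monic_char_poly[OF A] ds by simp
  then show "length es = n" using es by (metis mset_eq_length)
qed

lemma orthonormal_columns:
  fixes W :: "real mat"
  assumes "W \<in> carrier_mat d k" "W\<^sup>T * W = 1\<^sub>m k" "i < k" "j < k"
  shows "col W i \<bullet> col W j = (if i = j then 1 else 0)"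
proof -
  have "(W\<^sup>T * W) $$ (i, j) = col W i \<bullet> col W j" using assms(1,3,4) by simp
  then show ?thesis using assms by simp
qed

lemma parseval:
  fixes W :: "real mat"
  assumes W: "W \<in> carrier_mat n n" and WW: "W\<^sup>T * W = 1\<^sub>m n" and v: "v \<in> carrier_vec n"
  shows "v = vec n (\<lambda>k. \<Sum>j<n. (col W j \<bullet> v) * col W j $ k)"
proof -
  have "W * W\<^sup>T = 1\<^sub>m n" using mat_mult_left_right_inverse[of "W\<^sup>T" n W] W WW by auto
  then have "v = W *\<^sub>v (W\<^sup>T *\<^sub>v v)" using W v by (simp flip: assoc_mult_mat_vec)
  also have "\<dots> = vec n (\<lambda>k. \<Sum>j<n. (col W j \<bullet> v) * col W j $ k)"
    using W by (intro eq_vecI) (auto simp: scalar_prod_def atLeast0LessThan mult.commute intro!: sum.cong)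
  finally show ?thesis .
qed

text \<open>
  The existence of a singular value decomposition, for the singular values as they are defined here,
  through the sorted roots of the characteristic polynomial of \<open>X\<^sup>T * X\<close>. Take \<open>b\<close> an orthonormal
  eigenbasis in that order; the vectors \<open>t j = X *\<^sub>v b j\<close> are orthogonal with \<open>t j \<bullet> t j\<close> the \<open>j\<close>-th root, and
  \<open>a j\<close> is \<open>t j\<close> normalised, or zero where \<open>t j\<close> vanishes.
\<close>
lemma singular_value_expansion:
  assumes X: "X \<in> carrier_mat m n"
  shows "\<exists>a b. bilinear_expansion m n (min m n) X (\<lambda>j. singular_values X $ j) a b \<and>
    (\<forall>j<min m n. a j \<bullet> (X *\<^sub>v b j) = singular_values X $ j \<and> 0 \<le> singular_values X $ j)"
proof -
  define q where "q = min m n"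
  define es where "es = rev (sorted_list_of_multiset (proots (char_poly (X\<^sup>T * X))))"
  have G: "X\<^sup>T * X \<in> carrier_mat n n" using X by simp
  have sym: "(X\<^sup>T * X)\<^sup>T = X\<^sup>T * X" using X by (simp add: transpose_mult[of _ n m _ n])
  note eig = symmetric_orthonormal_eigenbasis[OF G sym, folded es_def]
  then obtain W where len: "length es = n" and W: "W \<in> carrier_mat n n" and WW: "W\<^sup>T * W = 1\<^sub>m n"
    and D: "W\<^sup>T * (X\<^sup>T * X) * W = mat n n (\<lambda>(i, j). if i = j then es ! i else 0)" by blast
  define b where "b = col W"
  define t where "t = (\<lambda>j. X *\<^sub>v b j)"
  define s where "s = (\<lambda>j. sqrt (es ! j))"
  define a where "a = (\<lambda>j. (1 / s j) \<cdot>\<^sub>v t j)"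
  have sv: "singular_values X $ j = s j" if "j < q" for j
    using that X by (simp add: singular_values_def s_def es_def q_def)
  have bc: "b j \<in> carrier_vec n" if "j < n" for j using W that unfolding b_def by simp
  have tc: "t j \<in> carrier_vec m" if "j < n" for j unfolding t_def using X bc[OF that] by simp
  have ac: "a j \<in> carrier_vec m" if "j < n" for j unfolding a_def using tc[OF that] by simp
  have tt: "t i \<bullet> t j = (if i = j then es ! i else 0)" if ij: "i < n" "j < n" for i j
  proof -
    have "t i \<bullet> t j = b i \<bullet> (X\<^sup>T *\<^sub>v t j)"
      using transpose_vec_mult_scalar[OF X bc[OF ij(1)] tc[OF ij(2)]] X
        tc[OF ij(1)] tc[OF ij(2)] bc[OF ij(1)]
      by (metis comm_scalar_prod mult_mat_vec_carrier t_def transpose_carrier_mat)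
    also have "X\<^sup>T *\<^sub>v t j = (X\<^sup>T * X) *\<^sub>v b j"
      unfolding t_def using X bc[OF ij(2)] by (subst assoc_mult_mat_vec[of _ n m _ n]) auto
    also have "b i \<bullet> ((X\<^sup>T * X) *\<^sub>v b j) = (W\<^sup>T * (X\<^sup>T * X) * W) $$ (i, j)"
      unfolding b_def using index_transpose_mult_mult[OF W G W ij] by simp
    finally show ?thesis unfolding D using ij by simp
  qed
  have es0: "0 \<le> es ! j" if "j < n" for j
    using tt[OF that that] scalar_prod_self_nonneg[of "t j"] by simp
  have s2: "s j * s j = es ! j" if "j < n" for j using es0[OF that] by (simp add: s_def)
  have aa: "a i \<bullet> a j = (if i = j \<and> es ! i \<noteq> 0 then 1 else 0)" if ij: "i < n" "j < n" for i j
  proof -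
    have "a i \<bullet> a j = (t i \<bullet> t j) / (s i * s j)"
      unfolding a_def using tc[OF ij(1)] tc[OF ij(2)] by simp
    then show ?thesis using tt[OF ij] s2[OF ij(1)] by auto
  qed
  have soa: "suborthonormal m n a"
    unfolding suborthonormal_def using ac aa by auto
  have sob: "suborthonormal n n b"
    unfolding suborthonormal_def using bc orthonormal_columns[OF W WW] by (auto simp: b_def)
  have dec: "es ! j \<le> es ! i" if "i \<le> j" "j < n" for i j
  proof -
    have "sorted_wrt (\<ge>) es" unfolding es_def by (simp add: sorted_wrt_rev)
    then show ?thesis using sorted_wrt_nth_less[of "(\<ge>)" es i j] that len by (cases "i = j") auto
  qed
  \<comment> \<open>If the root \<open>es ! j\<close> with \<open>j \<ge> m\<close> were positive, so would be all earlier ones, and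
    there would be \<open>j + 1 > m\<close> orthonormal vectors \<open>a i\<close> in dimension \<open>m\<close>.\<close>
  have vanish: "s j = 0" if j: "q \<le> j" "j < n" for j
  proof (rule ccontr)
    assume "s j \<noteq> 0"
    then have "0 < es ! j" using es0[OF j(2)] by (simp add: s_def)
    then have "a i \<bullet> a i = 1" if "i < Suc j" for i
      using aa[of i i] dec[of i j] that j by force
    then have "real (Suc j) = (\<Sum>i<Suc j. a i \<bullet> a i)" by simp
    also have "\<dots> \<le> real m"
      using j by (intro suborthonormal_norms_le_dim suborthonormal_subset[OF soa]) auto
    finally show False using j unfolding q_def by simp
  qed
  have expansion: "u \<bullet> (X *\<^sub>v w) = (\<Sum>j<q. s j * ((a j \<bullet> u) * (b j \<bullet> w)))"
    if u: "u \<in> carrier_vec m" and w: "w \<in> carrier_vec n" for u w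
  proof -
    have Xu: "X\<^sup>T *\<^sub>v u \<in> carrier_vec n" using X u by simp
    have move: "u \<bullet> (X *\<^sub>v y) = (X\<^sup>T *\<^sub>v u) \<bullet> y" if "y \<in> carrier_vec n" for y
      by (rule transpose_vec_mult_scalar[OF X that u, symmetric])
    have ut: "u \<bullet> t j = s j * (a j \<bullet> u)" if "j < n" for j
    proof (cases "s j = 0")
      case True
      then have "t j \<bullet> t j = 0" using tt[OF that that] s2[OF that] by simp
      then have "t j = 0\<^sub>v m" using scalar_prod_self_eq_0 tc[OF that] by blast
      then show ?thesis using True u by simp
    next
      case False
      then show ?thesis unfolding a_def using u tc[OF that] by (simp add: comm_scalar_prod[of u m])
    qed
    have "u \<bullet> (X *\<^sub>v w) = (X\<^sup>T *\<^sub>v u) \<bullet> vec n (\<lambda>k. \<Sum>j<n. (b j \<bullet> w) * b j $ k)"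
      using move[OF w] parseval[OF W WW w] unfolding b_def by simp
    also have "\<dots> = (\<Sum>j<n. (b j \<bullet> w) * ((X\<^sup>T *\<^sub>v u) \<bullet> b j))"
      using Xu bc by (rule scalar_prod_lincomb)
    also have "\<dots> = (\<Sum>j<n. s j * ((a j \<bullet> u) * (b j \<bullet> w)))"
      using move bc ut by (intro sum.cong) (auto simp: t_def)
    also have "\<dots> = (\<Sum>j<q. s j * ((a j \<bullet> u) * (b j \<bullet> w)))"
      using vanish by (intro sum.mono_neutral_right) (auto simp: q_def)
    finally show ?thesis .
  qed
  have "bilinear_expansion m n q X (\<lambda>j. singular_values X $ j) a b"
    unfolding bilinear_expansion_def
    using expansion sv suborthonormal_subset[OF soa, of q] suborthonormal_subset[OF sob, of q]
    by (auto simp: q_def)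
  moreover have "a j \<bullet> (X *\<^sub>v b j) = s j \<and> 0 \<le> s j" if "j < q" for j
  proof -
    have j: "j < n" using that by (simp add: q_def)
    have "a j \<bullet> t j = es ! j / s j" unfolding a_def using tc[OF j] tt[OF j j] by simp
    then show ?thesis using s2[OF j] es0[OF j] by (auto simp: t_def s_def real_div_sqrt)
  qed
  ultimately show ?thesis unfolding q_def[symmetric] using sv by auto
qed

lemma orthonormal_columns_le_dim:
  fixes U :: "real mat"
  assumes U: "U \<in> carrier_mat d k" "U\<^sup>T * U = 1\<^sub>m k"
  shows "k \<le> d"
proof -
  have "suborthonormal d k (col U)"
    using U orthonormal_columns[OF U] by (auto simp: suborthonormal_def)
  then have "(\<Sum>i<k. col U i \<bullet> col U i) \<le> real d" by (rule suborthonormal_norms_le_dim)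
  also have "(\<Sum>i<k. col U i \<bullet> col U i) = real k" using orthonormal_columns[OF U] by simp
  finally show ?thesis by simp
qed

section \<open>Monotone spectral functions and diagonals\<close>

text \<open>
  Weak majorization compares nonnegative vectors, while the entries of a diagonal may have any sign.
\<close>
lemma absolutely_symmetric_abs:
  assumes f: "absolutely_symmetric q f" and x: "x \<in> carrier_vec q"
  shows "f (vec q (\<lambda>i. \<bar>x $ i\<bar>)) = f x"
proof -
  define J where "J = mat_diag q (\<lambda>i. if x $ i < 0 then -1 else 1 :: real)"
  have "sign_matrix q J"
    unfolding sign_matrix_def J_def by (auto simp: diagonal_mat_def mat_diag_def)
  moreover have "permutation_matrix q (1\<^sub>m q)"
    unfolding permutation_matrix_def
    by (intro exI[of _ id] conjI permutes_id eq_matI) auto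
  moreover have IJ: "1\<^sub>m q * J = J" unfolding J_def by (rule left_mult_one_mat[OF mat_diag_dim])
  ultimately have "f (J *\<^sub>v x) = f x"
    using f x unfolding absolutely_symmetric_def by metis
  moreover have "J *\<^sub>v x = vec q (\<lambda>i. \<bar>x $ i\<bar>)"
  proof (rule eq_vecI)
    fix i assume "i < dim_vec (vec q (\<lambda>i. \<bar>x $ i\<bar>))"
    then have i: "i < q" by simp
    have "(J *\<^sub>v x) $ i = (\<Sum>j<q. (if i = j then if x $ j < 0 then -1 else 1 else 0) * x $ j)"
      using x i by (simp add: J_def mat_diag_def scalar_prod_def atLeast0LessThan)
    also have "\<dots> = (\<Sum>j<q. if j = i then \<bar>x $ i\<bar> else 0)"
      by (intro sum.cong) auto
    finally have "(J *\<^sub>v x) $ i = \<bar>x $ i\<bar>" using i by simp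
    then show "(J *\<^sub>v x) $ i = vec q (\<lambda>i. \<bar>x $ i\<bar>) $ i"
      using i by (simp add: J_def)
  qed (simp add: J_def mat_diag_def)
  ultimately show ?thesis by simp
qed

text \<open>
  The padding by zero vectors matches the padding of \<open>x\<close> by zeros in the vector problem.
\<close>
lemma suborthonormal_padded_columns:
  fixes U :: "real mat"
  assumes "U \<in> carrier_mat d k" "U\<^sup>T * U = 1\<^sub>m k" "p \<le> k"
  shows "suborthonormal d q (\<lambda>i. if i < p then col U i else 0\<^sub>v d)"
  using assms orthonormal_columns[OF assms(1,2)] unfolding suborthonormal_def by auto

lemma Diag_rect_sandwich_carrier:
  assumes "V \<in> carrier_mat m rb" "U \<in> carrier_mat n rc"
  shows "V * Diag_rect rb rc x * U\<^sup>T \<in> carrier_mat m n"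
  using assms by (intro mult_carrier_mat[of _ m rc] mult_carrier_mat[of _ m rb]) (auto simp: Diag_rect_def)

lemma bilinear_expansion_of_diagonal:
  assumes V: "V \<in> carrier_mat m rb" "V\<^sup>T * V = 1\<^sub>m rb" and U: "U \<in> carrier_mat n rc" "U\<^sup>T * U = 1\<^sub>m rc"
    and p: "p = min rb rc" "p \<le> q" and x: "x \<in> carrier_vec p"
  shows "bilinear_expansion m n q (V * Diag_rect rb rc x * U\<^sup>T) (\<lambda>j. (x @\<^sub>v 0\<^sub>v (q - p)) $ j)
    (\<lambda>i. if i < p then col V i else 0\<^sub>v m) (\<lambda>i. if i < p then col U i else 0\<^sub>v n)"
  unfolding bilinear_expansion_def
proof (intro conjI ballI)
  show "suborthonormal m q (\<lambda>i. if i < p then col V i else 0\<^sub>v m)"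
    using p by (intro suborthonormal_padded_columns[OF V]) auto
  show "suborthonormal n q (\<lambda>i. if i < p then col U i else 0\<^sub>v n)"
    using p by (intro suborthonormal_padded_columns[OF U]) auto
  fix u w :: "real vec"
  assume u: "u \<in> carrier_vec m" and w: "w \<in> carrier_vec n"
  let ?D = "Diag_rect rb rc x"
  have D: "?D \<in> carrier_mat rb rc" by (simp add: Diag_rect_def)
  define z where "z = U\<^sup>T *\<^sub>v w"
  have z: "z \<in> carrier_vec rc" unfolding z_def using U w by simp
  have Dz: "(?D *\<^sub>v z) $ i = (if i < p then x $ i * z $ i else 0)" if i: "i < rb" for i
  proof -
    have "(?D *\<^sub>v z) $ i = (\<Sum>j<rc. (if i = j then x $ i else 0) * z $ j)"
      using i z by (simp add: Diag_rect_def scalar_prod_def atLeast0LessThan)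
    also have "\<dots> = (\<Sum>j<rc. if j = i then x $ i * z $ i else 0)"
      by (intro sum.cong) auto
    finally show ?thesis using i p by simp
  qed
  have "(V * ?D * U\<^sup>T) *\<^sub>v w = (V * ?D) *\<^sub>v z"
    unfolding z_def using V D U w by (intro assoc_mult_mat_vec) auto
  also have "\<dots> = V *\<^sub>v (?D *\<^sub>v z)" using V D z by (intro assoc_mult_mat_vec) auto
  finally have "u \<bullet> (V * ?D * U\<^sup>T *\<^sub>v w) = (V\<^sup>T *\<^sub>v u) \<bullet> (?D *\<^sub>v z)"
    using transpose_vec_mult_scalar[OF V(1), of "?D *\<^sub>v z" u] D z u by simp
  also have "\<dots> = (\<Sum>i<rb. (col V i \<bullet> u) * (if i < p then x $ i * z $ i else 0))"
    using Dz V D by (simp add: scalar_prod_def[of "V\<^sup>T *\<^sub>v u"] atLeast0LessThan)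
  also have "\<dots> = (\<Sum>i<p. x $ i * ((col V i \<bullet> u) * (col U i \<bullet> w)))"
    using p U w by (intro sum.mono_neutral_cong_right) (auto simp: z_def)
  also have "\<dots> = (\<Sum>j<q. (x @\<^sub>v 0\<^sub>v (q - p)) $ j * (((if j < p then col V j else 0\<^sub>v m) \<bullet> u) *
      ((if j < p then col U j else 0\<^sub>v n) \<bullet> w)))"
    using p x u w by (intro sum.mono_neutral_cong_left) auto
  finally show "u \<bullet> (V * ?D * U\<^sup>T *\<^sub>v w) = \<dots>" .
qed

text \<open>
  Here \<open>X\<close> is expanded along its own singular vectors and tested on the columns of \<open>V\<close> and \<open>U\<close>.
\<close>
lemma weakly_majorized_diagonal_singular_values:
  assumes X: "X \<in> carrier_mat m n" and q: "q = min m n"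
    and V: "V \<in> carrier_mat m rb" "V\<^sup>T * V = 1\<^sub>m rb" and U: "U \<in> carrier_mat n rc" "U\<^sup>T * U = 1\<^sub>m rc"
    and p: "p = min rb rc" "p \<le> q"
  shows "weakly_majorized q (vec q (\<lambda>i. \<bar>(diag_vec (V\<^sup>T * X * U) @\<^sub>v 0\<^sub>v (q - p)) $ i\<bar>)) (singular_values X)"
proof -
  let ?v = "\<lambda>i. if i < p then col V i else 0\<^sub>v m" and ?u = "\<lambda>i. if i < p then col U i else 0\<^sub>v n"
  obtain a b where ab: "bilinear_expansion m n q X (\<lambda>j. singular_values X $ j) a b"
    and pos: "\<And>j. j < q \<Longrightarrow> 0 \<le> singular_values X $ j"
    using singular_value_expansion[OF X] unfolding q by blast
  have "weakly_majorized q (vec q (\<lambda>i. \<bar>?v i \<bullet> (X *\<^sub>v ?u i)\<bar>)) (vec q (\<lambda>j. \<bar>singular_values X $ j\<bar>))"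
    using p by (intro weakly_majorized_compression[OF ab] suborthonormal_padded_columns[OF V]
        suborthonormal_padded_columns[OF U]) auto
  also have "vec q (\<lambda>j. \<bar>singular_values X $ j\<bar>) = singular_values X"
    using pos X by (intro eq_vecI) (auto simp: singular_values_def q)
  also have "vec q (\<lambda>i. \<bar>?v i \<bullet> (X *\<^sub>v ?u i)\<bar>) = vec q (\<lambda>i. \<bar>(diag_vec (V\<^sup>T * X * U) @\<^sub>v 0\<^sub>v (q - p)) $ i\<bar>)"
  proof (rule eq_vecI)
    fix i assume "i < dim_vec (vec q (\<lambda>i. \<bar>(diag_vec (V\<^sup>T * X * U) @\<^sub>v 0\<^sub>v (q - p)) $ i\<bar>))"
    then have i: "i < q" by simp
    have d: "dim_vec (diag_vec (V\<^sup>T * X * U)) = p" using V U p by (simp add: diag_vec_def)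
    show "vec q (\<lambda>i. \<bar>?v i \<bullet> (X *\<^sub>v ?u i)\<bar>) $ i
        = vec q (\<lambda>i. \<bar>(diag_vec (V\<^sup>T * X * U) @\<^sub>v 0\<^sub>v (q - p)) $ i\<bar>) $ i"
    proof (cases "i < p")
      case True
      then have "diag_vec (V\<^sup>T * X * U) $ i = (V\<^sup>T * X * U) $$ (i, i)"
        using V U p by (simp add: diag_vec_def)
      also have "\<dots> = col V i \<bullet> (X *\<^sub>v col U i)"
        using True p by (intro index_transpose_mult_mult[OF V(1) X U(1)]) auto
      finally show ?thesis using True i d by simp
    next
      case False
      have "X *\<^sub>v 0\<^sub>v n \<in> carrier_vec m" using X by simp
      then show ?thesis using False i d by simp
    qed
  qed simp
  finally show ?thesis .
qed

text \<open>
  The same inequality with the roles exchanged: the matrix is expanded along the columns of \<open>V\<close> and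
  \<open>U\<close> and tested on its singular vectors. Together with the symmetry of \<open>f\<close> this stands in for
  computing the characteristic polynomial, whose roots are the squares of the \<open>x j\<close> and zeros.
\<close>
lemma weakly_majorized_singular_values_diagonal:
  assumes q: "q = min m n"
    and V: "V \<in> carrier_mat m rb" "V\<^sup>T * V = 1\<^sub>m rb" and U: "U \<in> carrier_mat n rc" "U\<^sup>T * U = 1\<^sub>m rc"
    and p: "p = min rb rc" "p \<le> q" and x: "x \<in> carrier_vec p"
  shows "weakly_majorized q (singular_values (V * Diag_rect rb rc x * U\<^sup>T))
    (vec q (\<lambda>i. \<bar>(x @\<^sub>v 0\<^sub>v (q - p)) $ i\<bar>))"
proof -
  let ?X = "V * Diag_rect rb rc x * U\<^sup>T"
  have X: "?X \<in> carrier_mat m n" using V(1) U(1) by (rule Diag_rect_sandwich_carrier)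
  obtain a b where ab: "bilinear_expansion m n q ?X (\<lambda>j. singular_values ?X $ j) a b"
    and diag: "\<And>j. j < q \<Longrightarrow> a j \<bullet> (?X *\<^sub>v b j) = singular_values ?X $ j"
    and pos: "\<And>j. j < q \<Longrightarrow> 0 \<le> singular_values ?X $ j"
    using singular_value_expansion[OF X] unfolding q by blast
  have "weakly_majorized q (vec q (\<lambda>i. \<bar>a i \<bullet> (?X *\<^sub>v b i)\<bar>)) (vec q (\<lambda>i. \<bar>(x @\<^sub>v 0\<^sub>v (q - p)) $ i\<bar>))"
    using ab by (intro weakly_majorized_compression[OF bilinear_expansion_of_diagonal[OF V U p x]])
      (auto simp: bilinear_expansion_def)
  also have "vec q (\<lambda>i. \<bar>a i \<bullet> (?X *\<^sub>v b i)\<bar>) = singular_values ?X"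
  proof (rule eq_vecI)
    show "dim_vec (vec q (\<lambda>i. \<bar>a i \<bullet> (?X *\<^sub>v b i)\<bar>)) = dim_vec (singular_values ?X)"
      using V U by (simp add: singular_values_def q)
    then show "vec q (\<lambda>i. \<bar>a i \<bullet> (?X *\<^sub>v b i)\<bar>) $ i = singular_values ?X $ i"
      if "i < dim_vec (singular_values ?X)" for i
      using that diag pos by simp
  qed
  finally show ?thesis .
qed

lemma singular_values_nonneg: 
  assumes "X \<in> carrier_mat m n" shows "singular_values X \<in> nonneg_vecs (min m n)"
proof -
  have "dim_vec (singular_values X) = min m n" using assms by (simp add: singular_values_def)
  moreover obtain a b where "\<forall>j<min m n. a j \<bullet> (X *\<^sub>v b j) = singular_values X $ j \<and> 0 \<le> singular_values X $ j"
    using singular_value_expansion[OF assms] by (elim exE conjE) rule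
  ultimately show ?thesis unfolding nonneg_vecs_def carrier_vec_def by simp
qed

text \<open>
  The two weak majorizations, read through a monotone symmetric function. Applied to \<open>f\<close> they compare
  objectives, applied to \<open>g\<close> they preserve feasibility.
\<close>
lemma
  assumes f: "absolutely_symmetric q f" "mono_weak_majorization q f" and q: "q = min m n"
    and V: "V \<in> carrier_mat m rb" "V\<^sup>T * V = 1\<^sub>m rb" and U: "U \<in> carrier_mat n rc" "U\<^sup>T * U = 1\<^sub>m rc"
    and p: "p = min rb rc" "p \<le> q"
  shows spectral_function_diagonal_le:
      "X \<in> carrier_mat m n \<Longrightarrow> f (diag_vec (V\<^sup>T * X * U) @\<^sub>v 0\<^sub>v (q - p)) \<le> f (singular_values X)"
    and spectral_function_of_diagonal_le:
      "x \<in> carrier_vec p \<Longrightarrow> f (singular_values (V * Diag_rect rb rc x * U\<^sup>T)) \<le> f (x @\<^sub>v 0\<^sub>v (q - p))"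
proof -
  have mono: "f x \<le> f y" if "x \<in> nonneg_vecs q" "y \<in> nonneg_vecs q" "weakly_majorized q x y" for x y
    using f(2) that unfolding mono_weak_majorization_def by blast
  have abs: "vec q (\<lambda>i. \<bar>x $ i\<bar>) \<in> nonneg_vecs q" for x :: "real vec"
    by (simp add: nonneg_vecs_def)
  have pad: "x @\<^sub>v 0\<^sub>v (q - p) \<in> carrier_vec q" if "x \<in> carrier_vec p" for x :: "real vec"
    using append_carrier_vec[OF that zero_carrier_vec, of "q - p"] p(2) by simp
  show "f (diag_vec (V\<^sup>T * X * U) @\<^sub>v 0\<^sub>v (q - p)) \<le> f (singular_values X)" if X: "X \<in> carrier_mat m n"
  proof -
    have "diag_vec (V\<^sup>T * X * U) \<in> carrier_vec p"
      using V U p by (intro carrier_vecI) (simp add: diag_vec_def)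
    from absolutely_symmetric_abs[OF f(1) pad[OF this]]
    show ?thesis
      using mono[OF abs _ weakly_majorized_diagonal_singular_values[OF X q V U p]]
        singular_values_nonneg[OF X] q by simp
  qed
  show "f (singular_values (V * Diag_rect rb rc x * U\<^sup>T)) \<le> f (x @\<^sub>v 0\<^sub>v (q - p))" if x: "x \<in> carrier_vec p"
  proof -
    have "V * Diag_rect rb rc x * U\<^sup>T \<in> carrier_mat m n"
      using V(1) U(1) by (rule Diag_rect_sandwich_carrier)
    from singular_values_nonneg[OF this] show ?thesis
      using mono[OF _ abs weakly_majorized_singular_values_diagonal[OF q V U p x]]
        absolutely_symmetric_abs[OF f(1) pad[OF x]] q by simp
  qed
qed

section \<open>Pinching under a unitarily invariant norm\<close>

lemma real_orthogonal_mat_transpose: "real_orthogonal_mat d U \<Longrightarrow> real_orthogonal_mat d U\<^sup>T"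
  by (simp add: real_orthogonal_mat_def)

text \<open>
  Indexed by \<open>k\<close> for induction: the step to \<open>Suc k\<close> affects row \<open>k\<close> and column \<open>k\<close> only, and a single sign
  flip accounts for it.
\<close>
definition pinch :: "nat \<Rightarrow> real mat \<Rightarrow> real mat" where
  "pinch k M = mat (dim_row M) (dim_col M)
     (\<lambda>(i, j). if (i < k \<or> j < k) \<and> i \<noteq> j then 0 else M $$ (i, j))"

lemma pinch_carrier: "M \<in> carrier_mat r s \<Longrightarrow> pinch k M \<in> carrier_mat r s"
  by (simp add: pinch_def)

text \<open>
  Pinching is an average over sign changes: flipping the sign of row \<open>k\<close> and of column \<open>k\<close> keeps the norm
  and the entry \<open>(k, k)\<close>, and negates all other entries in that row and column, so the mean of a matrix
  and its flip erases exactly those. Invariance and the triangle inequality give the bound.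
\<close>
lemma unitarily_invariant_norm_pinch_le:
  assumes N: "unitarily_invariant_norm r s N" and M: "M \<in> carrier_mat r s"
  shows "N (pinch k M) \<le> N M"
proof (induction k)
  case 0
  have "pinch 0 M = M" unfolding pinch_def by (intro eq_matI) auto
  then show ?case by simp
next
  case (Suc k)
  define J where "J = (\<lambda>d. mat_diag d (\<lambda>i. if i = k then -1 else 1 :: real))"
  have Jc: "J d \<in> carrier_mat d d" for d unfolding J_def by simp
  have JT: "(J d)\<^sup>T = J d" for d
    unfolding J_def mat_diag_def by (intro eq_matI) auto
  have JJ: "J d * J d = 1\<^sub>m d" for d
    unfolding J_def mat_diag_diag by (intro eq_matI) (auto simp: mat_diag_def)
  have Jo: "real_orthogonal_mat d (J d)" for d
    unfolding real_orthogonal_mat_def JT using Jc JJ by simp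
  define Q where "Q = pinch k M"
  have Q: "Q \<in> carrier_mat r s" unfolding Q_def using M by (rule pinch_carrier)
  define R where "R = J r * Q * (J s)\<^sup>T"
  have R: "R \<in> carrier_mat r s" unfolding R_def JT using Q Jc[of r] Jc[of s] by auto
  have entry: "R $$ (i, j) = (if i = k then -1 else 1) * Q $$ (i, j) * (if j = k then -1 else 1)"
    if "i < r" "j < s" for i j
    unfolding R_def JT using Q that unfolding J_def
    by (simp add: mat_diag_mult_left[OF Q] mat_diag_mult_right[of _ r s])
  have avg: "pinch (Suc k) M = (1 / 2) \<cdot>\<^sub>m Q + (1 / 2) \<cdot>\<^sub>m R"
  proof (rule eq_matI)
    fix i j assume "i < dim_row ((1 / 2) \<cdot>\<^sub>m Q + (1 / 2) \<cdot>\<^sub>m R)" "j < dim_col ((1 / 2) \<cdot>\<^sub>m Q + (1 / 2) \<cdot>\<^sub>m R)"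
    then have ij: "i < r" "j < s" using R by auto
    then show "pinch (Suc k) M $$ (i, j) = ((1 / 2) \<cdot>\<^sub>m Q + (1 / 2) \<cdot>\<^sub>m R) $$ (i, j)"
      using entry[OF ij] Q R M by (auto simp: Q_def pinch_def less_Suc_eq)
  qed (use Q R M in \<open>auto simp: pinch_def\<close>)
  have "N R = N Q"
    using N Q Jo unfolding R_def unitarily_invariant_norm_def by blast
  have hom: "N (a \<cdot>\<^sub>m Z) = \<bar>a\<bar> * N Z" if "Z \<in> carrier_mat r s" for a Z
    using N that unfolding unitarily_invariant_norm_def norm_on_def by blast
  have "N (pinch (Suc k) M) \<le> N ((1 / 2) \<cdot>\<^sub>m Q) + N ((1 / 2) \<cdot>\<^sub>m R)"
    unfolding avg using N Q R unfolding unitarily_invariant_norm_def norm_on_def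
    by (meson smult_carrier_mat)
  also have "\<dots> = N Q" using hom[OF Q] hom[OF R] \<open>N R = N Q\<close> by simp
  finally show ?case using Suc unfolding Q_def by linarith
qed

section \<open>The residual in coordinates adapted to the coefficient matrices\<close>

text \<open>
  A relaxation of \<^const>\<open>thin_svd\<close> that is visibly stable under transposition, so that every fact about
  the column space of a matrix also yields the one about its row space.
\<close>
definition compact_svd :: "nat \<Rightarrow> nat \<Rightarrow> nat \<Rightarrow> real mat \<Rightarrow> real mat \<Rightarrow> real mat \<Rightarrow> real mat \<Rightarrow> bool" where
  "compact_svd a b k M U S V \<longleftrightarrow>
     U \<in> carrier_mat a k \<and> U\<^sup>T * U = 1\<^sub>m k \<and> V \<in> carrier_mat b k \<and> V\<^sup>T * V = 1\<^sub>m k \<and>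
     S \<in> carrier_mat k k \<and> diagonal_mat S \<and> (\<forall>i<k. S $$ (i, i) \<noteq> 0) \<and> M = U * S * V\<^sup>T"

lemma compact_svd_of_thin_svd:
  assumes "thin_svd M U S V" "M \<in> carrier_mat a b"
  shows "compact_svd a b (vec_space.rank a M) M U S V"
proof -
  have d: "dim_row M = a" "dim_col M = b" using assms(2) by auto
  note svd = assms(1)[unfolded thin_svd_def Let_def d]
  then have "\<forall>i<vec_space.rank a M. S $$ (i, i) \<noteq> 0" by (metis less_numeral_extra(3))
  then show ?thesis using svd unfolding compact_svd_def by blast
qed

lemma mult_mat_vec_zero: "M \<in> carrier_mat a k \<Longrightarrow> (M :: real mat) *\<^sub>v 0\<^sub>v k = 0\<^sub>v a"
  by (intro eq_vecI) auto

lemma compact_svd_transpose: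
  assumes "compact_svd a b k M U S V"
  shows "compact_svd b a k M\<^sup>T V S U"
proof -
  have S: "S \<in> carrier_mat k k" "diagonal_mat S" and U: "U \<in> carrier_mat a k" and V: "V \<in> carrier_mat b k"
    and M: "M = U * S * V\<^sup>T"
    using assms unfolding compact_svd_def by auto
  have "S\<^sup>T = S"
  proof (rule eq_matI)
    fix i j assume "i < dim_row S" "j < dim_col S"
    then show "S\<^sup>T $$ (i, j) = S $$ (i, j)"
      using S unfolding diagonal_mat_def by (cases "i = j") auto
  qed (use S in auto)
  then have "M\<^sup>T = V * S * U\<^sup>T"
    unfolding M using U V S
    by (simp add: transpose_mult[of _ a k _ b] transpose_mult[of _ a k _ k] transpose_mult[of _ k k _ b]
        assoc_mult_mat[of _ b k _ k _ a])
  then show ?thesis using assms unfolding compact_svd_def by auto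
qed

text \<open>
  The columns of \<open>U\<close> lie in the range of \<open>M\<close> because \<open>M * V = U * S\<close> and the diagonal of \<open>S\<close> has no zeros.
\<close>
lemma
  assumes svd: "compact_svd a b k M U S V"
  shows compact_svd_mult_right: "M * V = U * S"
    and compact_svd_kernel: "\<lbrakk>v \<in> carrier_vec b; \<And>i. i < k \<Longrightarrow> col V i \<bullet> v = 0\<rbrakk> \<Longrightarrow> M *\<^sub>v v = 0\<^sub>v a"
    and compact_svd_range: "i < k \<Longrightarrow> \<exists>x\<in>carrier_vec b. M *\<^sub>v x = col U i"
proof -
  have S: "S \<in> carrier_mat k k" "diagonal_mat S" and U: "U \<in> carrier_mat a k" and V: "V \<in> carrier_mat b k"
    and VV: "V\<^sup>T * V = 1\<^sub>m k"
    and M: "M = U * S * V\<^sup>T" and nz: "\<And>i. i < k \<Longrightarrow> S $$ (i, i) \<noteq> 0"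
    using svd unfolding compact_svd_def by auto
  have US: "U * S \<in> carrier_mat a k" using U S by simp
  have Mc: "M \<in> carrier_mat a b" unfolding M using U S V by simp
  have "M * V = U * S * (V\<^sup>T * V)"
    unfolding M using US V by (intro assoc_mult_mat) auto
  then show MV: "M * V = U * S" unfolding VV right_mult_one_mat[OF US] .
  show "M *\<^sub>v v = 0\<^sub>v a" if v: "v \<in> carrier_vec b" and orth: "\<And>i. i < k \<Longrightarrow> col V i \<bullet> v = 0"
  proof -
    have "V\<^sup>T *\<^sub>v v = 0\<^sub>v k" using V orth by (intro eq_vecI) auto
    moreover have "M *\<^sub>v v = U * S *\<^sub>v (V\<^sup>T *\<^sub>v v)"
      unfolding M using US V v by (intro assoc_mult_mat_vec) auto
    ultimately show ?thesis using mult_mat_vec_zero[OF US] by metis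
  qed
  show "\<exists>x\<in>carrier_vec b. M *\<^sub>v x = col U i" if i: "i < k"
  proof (intro bexI)
    have vi: "col V i \<in> carrier_vec b" using V i by simp
    have "M *\<^sub>v col V i = col (U * S) i"
      using MV col_mult2[OF Mc V i] by simp
    also have "\<dots> = S $$ (i, i) \<cdot>\<^sub>v col U i"
    proof (rule eq_vecI)
      fix j assume "j < dim_vec (S $$ (i, i) \<cdot>\<^sub>v col U i)"
      then have j: "j < a" using U by simp
      have "col (U * S) i $ j = (\<Sum>l<k. U $$ (j, l) * S $$ (l, i))"
        using U S i j by (simp add: scalar_prod_def atLeast0LessThan)
      also have "\<dots> = (\<Sum>l<k. if l = i then U $$ (j, i) * S $$ (i, i) else 0)"
        using S i unfolding diagonal_mat_def by (intro sum.cong) auto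
      finally show "col (U * S) i $ j = (S $$ (i, i) \<cdot>\<^sub>v col U i) $ j"
        using U i j by simp
    qed (use U S in auto)
    finally have e: "M *\<^sub>v col V i = S $$ (i, i) \<cdot>\<^sub>v col U i" .
    have "M *\<^sub>v ((1 / S $$ (i, i)) \<cdot>\<^sub>v col V i) = (1 / S $$ (i, i)) \<cdot>\<^sub>v (M *\<^sub>v col V i)"
      using Mc vi by (rule mult_mat_vec)
    then show "M *\<^sub>v ((1 / S $$ (i, i)) \<cdot>\<^sub>v col V i) = col U i"
      unfolding e using nz[OF i] by (simp add: smult_smult_assoc)
    show "(1 / S $$ (i, i)) \<cdot>\<^sub>v col V i \<in> carrier_vec b" using vi by simp
  qed
qed

text \<open>
  For \<open>w \<in> W\<close> the difference \<open>w - P *\<^sub>v w\<close> lies in \<open>W\<close> and is orthogonal to \<open>W\<close>, hence to itself; for \<open>v\<close>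
  orthogonal to \<open>W\<close> the same holds for \<open>P *\<^sub>v v\<close>. Representing \<open>W\<close> as the range of a matrix provides its
  closure under differences.
\<close>
lemma
  assumes P: "orthogonal_projector d P W" and M: "M \<in> carrier_mat d e"
    and W: "W = {M *\<^sub>v x | x. x \<in> carrier_vec e}"
  shows orthogonal_projector_fixes: "w \<in> W \<Longrightarrow> P *\<^sub>v w = w"
    and orthogonal_projector_kills:
      "\<lbrakk>v \<in> carrier_vec d; \<And>w. w \<in> W \<Longrightarrow> v \<bullet> w = 0\<rbrakk> \<Longrightarrow> P *\<^sub>v v = 0\<^sub>v d"
proof -
  have Pc: "P \<in> carrier_mat d d" and PW: "\<And>v. v \<in> carrier_vec d \<Longrightarrow> P *\<^sub>v v \<in> W"
    and orth: "\<And>v w. v \<in> carrier_vec d \<Longrightarrow> w \<in> W \<Longrightarrow> (v - P *\<^sub>v v) \<bullet> w = 0"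
    using P unfolding orthogonal_projector_def by auto
  show "P *\<^sub>v w = w" if w: "w \<in> W"
  proof -
    obtain x where x: "x \<in> carrier_vec e" "w = M *\<^sub>v x" using w W by auto
    have wc: "w \<in> carrier_vec d" using x M by simp
    obtain y where y: "y \<in> carrier_vec e" "P *\<^sub>v w = M *\<^sub>v y" using PW[OF wc] W by auto
    have "w - P *\<^sub>v w = M *\<^sub>v (x - y)"
      using x y M by (simp add: mult_minus_distrib_mat_vec)
    then have "w - P *\<^sub>v w \<in> W" using x y W by auto
    then have "(w - P *\<^sub>v w) \<bullet> (w - P *\<^sub>v w) = 0" using orth[OF wc] by blast
    then have z: "w - P *\<^sub>v w = 0\<^sub>v d"
      using scalar_prod_self_eq_0[of "w - P *\<^sub>v w" d] wc Pc by simp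
    show ?thesis
    proof (rule eq_vecI)
      fix i assume "i < dim_vec w"
      then have "i < d" using wc by simp
      then show "(P *\<^sub>v w) $ i = w $ i"
        using arg_cong[OF z, of "\<lambda>u. u $ i"] wc Pc by simp
    qed (use wc Pc in auto)
  qed
  show "P *\<^sub>v v = 0\<^sub>v d" if v: "v \<in> carrier_vec d" and vW: "\<And>w. w \<in> W \<Longrightarrow> v \<bullet> w = 0"
  proof -
    have Pv: "P *\<^sub>v v \<in> carrier_vec d" using Pc v by simp
    have "(P *\<^sub>v v) \<bullet> (P *\<^sub>v v) = 0"
      using orth[OF v PW[OF v]] vW[OF PW[OF v]] v Pv by (simp add: minus_scalar_prod_distrib)
    then show ?thesis using scalar_prod_self_eq_0[OF Pv] by simp
  qed
qed

lemma
  assumes oc: "orthogonal_completion d U U'" and U: "U \<in> carrier_mat d k"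
  defines "W \<equiv> mat_of_cols d (cols U @ cols U')"
  shows orthogonal_completion_le: "k \<le> d"
    and orthogonal_completion_orthogonal: "real_orthogonal_mat d W"
    and orthogonal_completion_col_left: "i < k \<Longrightarrow> col W i = col U i"
    and orthogonal_completion_col_right: "i < d - k \<Longrightarrow> col W (k + i) = col U' i"
    and orthogonal_completion_orth: "i < k \<Longrightarrow> j < d - k \<Longrightarrow> col U i \<bullet> col U' j = 0"
proof -
  have U': "U' \<in> carrier_mat d (d - k)" and W: "real_orthogonal_mat d W"
    using oc U unfolding orthogonal_completion_def W_def by auto
  show "real_orthogonal_mat d W" by fact
  have Wc: "W \<in> carrier_mat d d" and WW: "W\<^sup>T * W = 1\<^sub>m d" using W by (auto simp: real_orthogonal_mat_def)
  have "dim_col W = k + (d - k)" unfolding W_def using U U' by simp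
  then show kd: "k \<le> d" using Wc by simp
  have col: "col W i = (cols U @ cols U') ! i" if "i < d" for i
    unfolding W_def
  proof (rule col_mat_of_cols)
    show "i < length (cols U @ cols U')" using that U U' kd by simp
    show "(cols U @ cols U') ! i \<in> carrier_vec d"
      using that U U' kd by (auto simp: nth_append)
  qed
  show l: "col W i = col U i" if "i < k" for i using col[of i] that U kd by (simp add: nth_append)
  show rgt: "col W (k + i) = col U' i" if "i < d - k" for i
    using col[of "k + i"] that U U' by (simp add: nth_append)
  show "col U i \<bullet> col U' j = 0" if "i < k" "j < d - k"
    using orthonormal_columns[OF Wc WW, of i "k + j"] l[OF that(1)] rgt[OF that(2)] that by simp
qed

text \<open>
  Pass to the orthogonal coordinates given by \<open>[U U']\<close> and \<open>[V V']\<close>.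
\<close>
lemma unitarily_invariant_norm_block_diagonal:
  assumes N: "unitarily_invariant_norm r s N" and M: "M \<in> carrier_mat r s"
    and U: "U \<in> carrier_mat r k" "orthogonal_completion r U U'"
    and V: "V \<in> carrier_mat s l" "orthogonal_completion s V V'"
    and off1: "\<And>i j. i < k \<Longrightarrow> j < s - l \<Longrightarrow> col U i \<bullet> (M *\<^sub>v col V' j) = 0"
    and off2: "\<And>i j. i < r - k \<Longrightarrow> j < l \<Longrightarrow> col U' i \<bullet> (M *\<^sub>v col V j) = 0"
  shows "N M = N (four_block_mat (U\<^sup>T * M * V) (0\<^sub>m k (s - l)) (0\<^sub>m (r - k) l) (U'\<^sup>T * M * V'))"
proof -
  define P where "P = mat_of_cols r (cols U @ cols U')"
  define Q where "Q = mat_of_cols s (cols V @ cols V')"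
  note cU = orthogonal_completion_le[OF U(2,1)] orthogonal_completion_orthogonal[OF U(2,1), folded P_def]
    orthogonal_completion_col_left[OF U(2,1), folded P_def]
    orthogonal_completion_col_right[OF U(2,1), folded P_def]
  note cV = orthogonal_completion_le[OF V(2,1)] orthogonal_completion_orthogonal[OF V(2,1), folded Q_def]
    orthogonal_completion_col_left[OF V(2,1), folded Q_def]
    orthogonal_completion_col_right[OF V(2,1), folded Q_def]
  have P: "P \<in> carrier_mat r r" and Q: "Q \<in> carrier_mat s s"
    using cU(2) cV(2) by (auto simp: real_orthogonal_mat_def)
  have U': "U' \<in> carrier_mat r (r - k)" and V': "V' \<in> carrier_mat s (s - l)"
    using U V by (auto simp: orthogonal_completion_def)
  have "P\<^sup>T * M * Q = four_block_mat (U\<^sup>T * M * V) (0\<^sub>m k (s - l)) (0\<^sub>m (r - k) l) (U'\<^sup>T * M * V')" (is "_ = ?B")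
  proof (rule eq_matI)
    have dims: "dim_row ?B = r" "dim_col ?B = s" using U V U' V' cU(1) cV(1) by auto
    fix i j assume "i < dim_row ?B" "j < dim_col ?B"
    then have ij: "i < r" "j < s" using dims by auto
    have e: "(P\<^sup>T * M * Q) $$ (i, j) = col P i \<bullet> (M *\<^sub>v col Q j)"
      using index_transpose_mult_mult[OF P M Q ij] .
    show "(P\<^sup>T * M * Q) $$ (i, j) = ?B $$ (i, j)"
    proof (cases "i < k")
      case True
      show ?thesis
      proof (cases "j < l")
        case True
        then show ?thesis
          unfolding e using \<open>i < k\<close> U V U' V' ij cU(3) cV(3) index_transpose_mult_mult[OF U(1) M V(1), of i j]
          by simp
      next
        case False
        then have "j - l < s - l" "l + (j - l) = j" using ij by auto
        then show ?thesis
          unfolding e using \<open>i < k\<close> False U V U' V' ij cU(3) cV(4)[of "j - l"] off1[of i "j - l"]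
          by simp
      qed
    next
      case False
      then have i: "i - k < r - k" "k + (i - k) = i" using ij by auto
      show ?thesis
      proof (cases "j < l")
        case True
        then show ?thesis
          unfolding e using False i U V U' V' ij cU(4)[of "i - k"] cV(3) off2[of "i - k" j]
          by simp
      next
        case jl: False
        then have "j - l < s - l" "l + (j - l) = j" using ij by auto
        then show ?thesis
          unfolding e using False i jl U V U' V' ij cU(4)[of "i - k"] cV(4)[of "j - l"]
            index_transpose_mult_mult[OF U' M V', of "i - k" "j - l"]
          by simp
      qed
    qed
  qed (use U V U' V' P Q cU(1) cV(1) in auto)
  moreover have "N (P\<^sup>T * M * (Q\<^sup>T)\<^sup>T) = N M"
    using N M real_orthogonal_mat_transpose[OF cU(2)] real_orthogonal_mat_transpose[OF cV(2)]
    unfolding unitarily_invariant_norm_def by blast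
  ultimately show ?thesis by simp
qed

text \<open>
  In the coordinates \<open>[UB UBp]\<close> and \<open>[VC VCp]\<close> the matrix \<open>B * X * C\<close> lives in the upper left block only,
  since \<open>C\<close> kills the columns of \<open>VCp\<close> and \<open>B\<^sup>T\<close> those of \<open>UBp\<close>. The two projector identities say that \<open>A\<close>
  has no off-diagonal blocks. Hence only the upper left block of the residual depends on \<open>X\<close>, and it
  does so through \<open>VB\<^sup>T * X * UC\<close>.
\<close>
lemma residual_norm_block_form:
  assumes N: "unitarily_invariant_norm r s N"
    and A: "A \<in> carrier_mat r s" and B: "B \<in> carrier_mat r m" and C: "C \<in> carrier_mat n s"
    and X: "X \<in> carrier_mat m n"
    and svd_B: "compact_svd r m k B UB SB VB" and svd_C: "compact_svd n s l C UC SC VC"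
    and UBp: "orthogonal_completion r UB UBp" and VCp: "orthogonal_completion s VC VCp"
    and PB: "orthogonal_projector r PB {B *\<^sub>v x | x. x \<in> carrier_vec m}"
    and PC: "orthogonal_projector s PC {C\<^sup>T *\<^sub>v x | x. x \<in> carrier_vec n}"
    and AC: "(1\<^sub>m r - PB) * A * PC = 0\<^sub>m r s"
    and BA: "PB * A * (1\<^sub>m s - PC) = 0\<^sub>m r s"
  shows "N (A - B * X * C) = N (four_block_mat (UB\<^sup>T * A * VC - SB * (VB\<^sup>T * X * UC) * SC)
    (0\<^sub>m k (s - l)) (0\<^sub>m (r - k) l) (UBp\<^sup>T * A * VCp))"
proof -
  let ?M = "A - B * X * C"
  have BX: "B * X \<in> carrier_mat r n" and BXC: "B * X * C \<in> carrier_mat r s" using B X C by auto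
  have M: "?M \<in> carrier_mat r s" using BXC by (rule minus_carrier_mat)
  have U: "UB \<in> carrier_mat r k" "UB\<^sup>T * UB = 1\<^sub>m k" "VB \<in> carrier_mat m k" "SB \<in> carrier_mat k k"
    "B = UB * SB * VB\<^sup>T"
    and V: "VC \<in> carrier_mat s l" "UC \<in> carrier_mat n l" "SC \<in> carrier_mat l l"
    using svd_B svd_C unfolding compact_svd_def by auto
  have U': "UBp \<in> carrier_mat r (r - k)" and V': "VCp \<in> carrier_mat s (s - l)"
    using UBp VCp U V by (auto simp: orthogonal_completion_def)
  note kernel_BT = compact_svd_kernel[OF compact_svd_transpose[OF svd_B]]
  note kernel_C = compact_svd_kernel[OF svd_C]
  have PBc: "PB \<in> carrier_mat r r" and PCc: "PC \<in> carrier_mat s s"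
    using PB PC by (auto simp: orthogonal_projector_def)
  have u: "col UB i \<in> carrier_vec r" if "i < k" for i using U that by simp
  have u': "col UBp i \<in> carrier_vec r" if "i < r - k" for i using U' that by simp
  have v: "col VC i \<in> carrier_vec s" if "i < l" for i using V that by simp
  have v': "col VCp i \<in> carrier_vec s" if "i < s - l" for i using V' that by simp
  have Cv': "C *\<^sub>v col VCp j = 0\<^sub>v n" if "j < s - l" for j
    using orthogonal_completion_orth[OF VCp V(1)] that by (intro kernel_C v') auto
  have BTu': "B\<^sup>T *\<^sub>v col UBp i = 0\<^sub>v m" if "i < r - k" for i
    using orthogonal_completion_orth[OF UBp U(1)] that by (intro kernel_BT u') auto
  have Mv': "?M *\<^sub>v col VCp j = A *\<^sub>v col VCp j" if j: "j < s - l" for j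
  proof -
    have "B * X * C *\<^sub>v col VCp j = B * X *\<^sub>v (C *\<^sub>v col VCp j)"
      using BX C v'[OF j] by (rule assoc_mult_mat_vec)
    also have "\<dots> = 0\<^sub>v r" unfolding Cv'[OF j] by (rule mult_mat_vec_zero[OF BX])
    finally show ?thesis
      using minus_mult_distrib_mat_vec[OF A BXC v'[OF j]] A v'[OF j] by simp
  qed
  have u'M: "col UBp i \<bullet> (?M *\<^sub>v w) = col UBp i \<bullet> (A *\<^sub>v w)" if i: "i < r - k" and w: "w \<in> carrier_vec s" for i w
  proof -
    have y: "X *\<^sub>v (C *\<^sub>v w) \<in> carrier_vec m" using X C w by auto
    have "C *\<^sub>v w \<in> carrier_vec n" using C w by simp
    then have "B * X * C *\<^sub>v w = B *\<^sub>v (X *\<^sub>v (C *\<^sub>v w))"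
      unfolding assoc_mult_mat_vec[OF BX C w] by (rule assoc_mult_mat_vec[OF B X])
    then have "col UBp i \<bullet> (B * X * C *\<^sub>v w) = (B\<^sup>T *\<^sub>v col UBp i) \<bullet> (X *\<^sub>v (C *\<^sub>v w))"
      using transpose_vec_mult_scalar[OF B y u'[OF i]] by simp
    also have "\<dots> = 0" unfolding BTu'[OF i] using y by simp
    finally show ?thesis
      using minus_mult_distrib_mat_vec[OF A BXC w] scalar_prod_minus_distrib[OF u'[OF i], of "A *\<^sub>v w" "B * X * C *\<^sub>v w"]
        A BXC w by simp
  qed
  have off1: "col UB i \<bullet> (?M *\<^sub>v col VCp j) = 0" if i: "i < k" and j: "j < s - l" for i j
  proof -
    let ?y = "A *\<^sub>v col VCp j"
    have y: "?y \<in> carrier_vec r" using A v'[OF j] by simp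
    \<comment> \<open>\<open>PC\<close> kills the column of \<open>VCp\<close>, so the second projector identity reduces to
      \<open>PB *\<^sub>v ?y = 0\<close>, and the column of \<open>UB\<close> does not see \<open>?y - PB *\<^sub>v ?y\<close>.\<close>
    have "PC *\<^sub>v col VCp j = 0\<^sub>v s"
    proof (rule orthogonal_projector_kills[OF PC _ refl v'[OF j]])
      show "C\<^sup>T \<in> carrier_mat s n" using C by simp
      fix w assume "w \<in> {C\<^sup>T *\<^sub>v x |x. x \<in> carrier_vec n}"
      then obtain x where x: "x \<in> carrier_vec n" "w = C\<^sup>T *\<^sub>v x" by blast
      have "col VCp j \<bullet> w = (C *\<^sub>v col VCp j) \<bullet> x"
        unfolding x(2) using transpose_vec_mult_scalar[of "C\<^sup>T" s n x "col VCp j"] C x(1) v'[OF j] by simp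
      then show "col VCp j \<bullet> w = 0" using Cv'[OF j] x(1) by simp
    qed
    then have "(1\<^sub>m s - PC) *\<^sub>v col VCp j = col VCp j"
      using minus_mult_distrib_mat_vec[OF one_carrier_mat PCc v'[OF j]] v'[OF j] by simp
    moreover have "PB * A * (1\<^sub>m s - PC) *\<^sub>v col VCp j = PB * A *\<^sub>v ((1\<^sub>m s - PC) *\<^sub>v col VCp j)"
      using PBc A PCc v'[OF j] by (intro assoc_mult_mat_vec) auto
    moreover have "PB * A *\<^sub>v col VCp j = PB *\<^sub>v ?y"
      using PBc A v'[OF j] by (rule assoc_mult_mat_vec)
    moreover have "0\<^sub>m r s *\<^sub>v col VCp j = 0\<^sub>v r" using v'[OF j] by (intro eq_vecI) auto
    ultimately have "PB *\<^sub>v ?y = 0\<^sub>v r" unfolding BA by metis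
    moreover have "col UB i \<in> {B *\<^sub>v x | x. x \<in> carrier_vec m}"
      using compact_svd_range[OF svd_B i] by (metis (mono_tags, lifting) mem_Collect_eq)
    then have "(?y - PB *\<^sub>v ?y) \<bullet> col UB i = 0"
      using PB y unfolding orthogonal_projector_def by blast
    ultimately have "?y \<bullet> col UB i = 0" using y by simp
    then show ?thesis unfolding Mv'[OF j] using comm_scalar_prod[OF y u[OF i]] by simp
  qed
  have off2: "col UBp i \<bullet> (?M *\<^sub>v col VC j) = 0" if i: "i < r - k" and j: "j < l" for i j
  proof -
    let ?y = "A *\<^sub>v col VC j"
    have y: "?y \<in> carrier_vec r" using A v[OF j] by simp
    \<comment> \<open>\<open>PC\<close> fixes the column of \<open>VC\<close>, so the first projector identity says that \<open>?y\<close> lies in the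
      column space of \<open>B\<close>, to which the column of \<open>UBp\<close> is orthogonal.\<close>
    have "PC *\<^sub>v col VC j = col VC j"
    proof (rule orthogonal_projector_fixes[OF PC _ refl])
      show "C\<^sup>T \<in> carrier_mat s n" using C by simp
      show "col VC j \<in> {C\<^sup>T *\<^sub>v x |x. x \<in> carrier_vec n}"
        using compact_svd_range[OF compact_svd_transpose[OF svd_C] j] by (metis (mono_tags, lifting) mem_Collect_eq)
    qed
    moreover have "(1\<^sub>m r - PB) * A * PC *\<^sub>v col VC j = (1\<^sub>m r - PB) * A *\<^sub>v (PC *\<^sub>v col VC j)"
      using PBc A PCc v[OF j] by (intro assoc_mult_mat_vec) auto
    moreover have "(1\<^sub>m r - PB) * A *\<^sub>v col VC j = (1\<^sub>m r - PB) *\<^sub>v ?y"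
      using PBc A v[OF j] by (intro assoc_mult_mat_vec) auto
    moreover have "0\<^sub>m r s *\<^sub>v col VC j = 0\<^sub>v r" using v[OF j] by (intro eq_vecI) auto
    moreover have "(1\<^sub>m r - PB) *\<^sub>v ?y = ?y - PB *\<^sub>v ?y"
      using minus_mult_distrib_mat_vec[OF one_carrier_mat PBc y] y by simp
    ultimately have z: "?y - PB *\<^sub>v ?y = 0\<^sub>v r" unfolding AC by metis
    have Py: "PB *\<^sub>v ?y \<in> carrier_vec r" using PBc y by simp
    obtain x where x: "x \<in> carrier_vec m" "PB *\<^sub>v ?y = B *\<^sub>v x"
      using PB y unfolding orthogonal_projector_def by blast
    have "col UBp i \<bullet> (PB *\<^sub>v ?y) = (B\<^sup>T *\<^sub>v col UBp i) \<bullet> x"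
      unfolding x(2) using transpose_vec_mult_scalar[OF B x(1) u'[OF i]] by simp
    then have "col UBp i \<bullet> (PB *\<^sub>v ?y) = 0" unfolding BTu'[OF i] using x(1) by simp
    moreover have "col UBp i \<bullet> (?y - PB *\<^sub>v ?y) = 0" unfolding z using u'[OF i] by simp
    ultimately have "col UBp i \<bullet> ?y = 0"
      using scalar_prod_minus_distrib[OF u'[OF i] y Py] by simp
    then show ?thesis using u'M[OF i v[OF j]] by simp
  qed
  have "N ?M = N (four_block_mat (UB\<^sup>T * ?M * VC) (0\<^sub>m k (s - l)) (0\<^sub>m (r - k) l) (UBp\<^sup>T * ?M * VCp))"
    using N M U(1) UBp V(1) VCp off1 off2 by (rule unitarily_invariant_norm_block_diagonal)
  moreover have "UBp\<^sup>T * ?M * VCp = UBp\<^sup>T * A * VCp"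
  proof (rule eq_matI)
    fix i j assume "i < dim_row (UBp\<^sup>T * A * VCp)" "j < dim_col (UBp\<^sup>T * A * VCp)"
    then have ij: "i < r - k" "j < s - l" using U' V' by auto
    show "(UBp\<^sup>T * ?M * VCp) $$ (i, j) = (UBp\<^sup>T * A * VCp) $$ (i, j)"
      using index_transpose_mult_mult[OF U' M V' ij] index_transpose_mult_mult[OF U' A V' ij] Mv'[OF ij(2)]
      by simp
  qed (use U' V' in auto)
  moreover have "UB\<^sup>T * ?M * VC = UB\<^sup>T * A * VC - SB * (VB\<^sup>T * X * UC) * SC"
  proof -
    have UT: "UB\<^sup>T \<in> carrier_mat k r"
      using U by auto
    have SV: "SB * VB\<^sup>T \<in> carrier_mat k m" using U by simp
    have "UB\<^sup>T * B = UB\<^sup>T * UB * (SB * VB\<^sup>T)"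
      unfolding U(5) using U(1,3,4) by (simp add: assoc_mult_mat[of _ r k _ k _ m] assoc_mult_mat[of _ k r _ k _ m])
    also have "\<dots> = SB * VB\<^sup>T" unfolding U(2) by (rule left_mult_one_mat[OF SV])
    finally have UTB: "UB\<^sup>T * B = SB * VB\<^sup>T" .
    have "UB\<^sup>T * (B * X * C) * VC = UB\<^sup>T * B * X * (C * VC)"
      using UT B X C V(1) by (simp add: assoc_mult_mat[of _ k r _ m _ n] assoc_mult_mat[of _ k r _ n _ s]
          assoc_mult_mat[of _ k r _ n _ l] assoc_mult_mat[of _ k r _ s _ l] assoc_mult_mat[of _ r n _ s _ l]
          assoc_mult_mat[of _ r m _ s _ l] assoc_mult_mat[of _ m n _ s _ l] assoc_mult_mat[of _ r m _ n _ l])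
    also have "\<dots> = SB * VB\<^sup>T * X * (UC * SC)"
      unfolding UTB compact_svd_mult_right[OF svd_C] ..
    also have "\<dots> = SB * (VB\<^sup>T * X * UC) * SC"
      using U(3,4) V(2,3) X
      by (simp add: assoc_mult_mat[of _ k k _ m _ n] assoc_mult_mat[of _ k k _ n _ l]
          assoc_mult_mat[of _ k m _ n _ l] assoc_mult_mat[of _ k n _ l _ l] assoc_mult_mat[of _ k k _ l _ l]
          assoc_mult_mat[of _ m n _ l _ l] assoc_mult_mat[of _ k m _ l _ l] assoc_mult_mat[of _ k k _ m _ l])
    finally have "UB\<^sup>T * (B * X * C) * VC = SB * (VB\<^sup>T * X * UC) * SC" .
    moreover have "UB\<^sup>T * ?M * VC = UB\<^sup>T * A * VC - UB\<^sup>T * (B * X * C) * VC"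
      using UT A BXC V(1) by (simp add: mult_minus_distrib_mat[of _ k r _ s] minus_mult_distrib_mat[of _ k s _ _ l])
    ultimately show ?thesis by simp
  qed
  ultimately show ?thesis by simp
qed

lemma diagonal_mat_sandwich_index:
  fixes Y :: "real mat"
  assumes S: "S \<in> carrier_mat k k" "diagonal_mat S" and T: "T \<in> carrier_mat l l" "diagonal_mat T"
    and Y: "Y \<in> carrier_mat k l" and ij: "i < k" "j < l"
  shows "(S * Y * T) $$ (i, j) = S $$ (i, i) * Y $$ (i, j) * T $$ (j, j)"
proof -
  have D: "M = mat_diag d (\<lambda>i. M $$ (i, i))" if "M \<in> carrier_mat d d" "diagonal_mat M" for M :: "real mat" and d
    using that by (intro eq_matI) (auto simp: mat_diag_def diagonal_mat_def)
  have "S * Y = mat k l (\<lambda>(i, j). S $$ (i, i) * Y $$ (i, j))"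
    by (subst D[OF S]) (rule mat_diag_mult_left[OF Y])
  then have "S * Y * T = mat k l (\<lambda>(i, j). mat k l (\<lambda>(i, j). S $$ (i, i) * Y $$ (i, j)) $$ (i, j) * T $$ (j, j))"
    by (subst D[OF T]) (simp add: mat_diag_mult_right[of _ k l])
  then show ?thesis using ij by simp
qed

text \<open>
  As \<open>S\<close>, \<open>T\<close> and \<open>E\<close> are diagonal, erasing the off-diagonal entries of \<open>E - S * Y * T\<close> amounts to erasing
  those of \<open>Y\<close>. Pinching \<open>min k l\<close> rows and columns does this and leaves \<open>D\<close> alone, even though \<open>D\<close> is off
  the main diagonal when \<open>k \<noteq> l\<close>.
\<close>
lemma pinch_residual_block:
  fixes D :: "real mat"
  assumes S: "S \<in> carrier_mat k k" "diagonal_mat S" and T: "T \<in> carrier_mat l l" "diagonal_mat T"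
    and Y: "Y \<in> carrier_mat k l" and E: "E \<in> carrier_mat k l" "diagonal_mat E"
    and D: "D \<in> carrier_mat k' l'"
  shows "pinch (min k l) (four_block_mat (E - S * Y * T) (0\<^sub>m k l') (0\<^sub>m k' l) D)
    = four_block_mat (E - S * Diag_rect k l (diag_vec Y) * T) (0\<^sub>m k l') (0\<^sub>m k' l) D"
proof -
  have R: "Diag_rect k l (diag_vec Y) \<in> carrier_mat k l" by (simp add: Diag_rect_def)
  have c: "S * Y * T \<in> carrier_mat k l" "S * Diag_rect k l (diag_vec Y) * T \<in> carrier_mat k l"
    using S T Y R by auto
  have e: "E $$ (i, j) = 0" if "i < k" "j < l" "i \<noteq> j" for i j
    using E that unfolding diagonal_mat_def by auto
  have entry: "(E - S * Diag_rect k l (diag_vec Y) * T) $$ (i, j)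
      = (if i = j then (E - S * Y * T) $$ (i, j) else 0)" if ij: "i < k" "j < l" for i j
  proof -
    have "Diag_rect k l (diag_vec Y) $$ (i, j) = (if i = j then Y $$ (i, j) else 0)"
      using ij Y by (simp add: Diag_rect_def diag_vec_def)
    moreover have m: "(E - M) $$ (i, j) = E $$ (i, j) - M $$ (i, j)" if "M \<in> carrier_mat k l" for M
      using that ij by auto
    ultimately show ?thesis
      unfolding m[OF c(1)] m[OF c(2)]
      using e[OF ij] diagonal_mat_sandwich_index[OF S T Y ij] diagonal_mat_sandwich_index[OF S T R ij]
      by (cases "i = j") auto
  qed
  have d: "dim_row (E - S * Y * T) = k" "dim_col (E - S * Y * T) = l"
    "dim_row (E - S * Diag_rect k l (diag_vec Y) * T) = k"
    "dim_col (E - S * Diag_rect k l (diag_vec Y) * T) = l" "dim_row D = k'" "dim_col D = l'"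
    using c D by auto
  show ?thesis
  proof (rule eq_matI)
    fix i j
    assume "i < dim_row (four_block_mat (E - S * Diag_rect k l (diag_vec Y) * T) (0\<^sub>m k l') (0\<^sub>m k' l) D)"
      and "j < dim_col (four_block_mat (E - S * Diag_rect k l (diag_vec Y) * T) (0\<^sub>m k l') (0\<^sub>m k' l) D)"
    then have ij: "i < k + k'" "j < l + l'" using d by auto
    show "pinch (min k l) (four_block_mat (E - S * Y * T) (0\<^sub>m k l') (0\<^sub>m k' l) D) $$ (i, j)
      = four_block_mat (E - S * Diag_rect k l (diag_vec Y) * T) (0\<^sub>m k l') (0\<^sub>m k' l) D $$ (i, j)"
      using ij entry[of i j] d
      by (cases "i < k"; cases "j < l") (auto simp: pinch_def simp del: index_minus_mat)
  qed (simp_all add: pinch_def d)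
qed

section \<open>Equivalence of the matrix and the vector problem\<close>

text \<open>
  The image of an optimal point costs no more than that point, hence no more than the point that any
  competitor is mapped to, which in turn costs no more than the competitor.
\<close>
lemma optimal_solution_transfer:
  assumes forward: "\<And>X. X \<in> S \<Longrightarrow> k X \<in> T \<and> objT (k X) \<le> objS X"
    and backward: "\<And>x. x \<in> T \<Longrightarrow> h x \<in> S \<and> objS (h x) \<le> objT x"
  shows "((\<exists>X. optimal_solution S objS X) \<longleftrightarrow> (\<exists>x. optimal_solution T objT x)) \<and>
    (\<forall>x. optimal_solution T objT x \<longrightarrow> optimal_solution S objS (h x)) \<and>
    (\<forall>X. optimal_solution S objS X \<longrightarrow> optimal_solution T objT (k X))"
proof -
  have "optimal_solution S objS (h x)" if "optimal_solution T objT x" for x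
    using that forward backward unfolding optimal_solution_def by (meson order_trans)
  moreover have "optimal_solution T objT (k X)" if "optimal_solution S objS X" for X
    using that forward backward unfolding optimal_solution_def by (meson order_trans)
  ultimately show ?thesis by blast
qed

theorem theorem3p8:
  fixes r s m n q qbar rb rc p :: nat
    and A B C PB PC UB SB VB UC SC VC UBp VCp :: "real mat"
    and c \<mu> :: real
    and N :: "real mat \<Rightarrow> real" and \<phi> :: "real vec \<Rightarrow> real"
    and F G :: "real mat \<Rightarrow> ereal" and f g :: "real vec \<Rightarrow> ereal"
    and l :: "real \<Rightarrow> ereal"
  assumes A: "A \<in> carrier_mat r s"
    and B: "B \<in> carrier_mat r m"
    and C: "C \<in> carrier_mat n s"
    and mu: "0 \<le> \<mu>"
    and q: "q = min m n"
    and qbar: "qbar = min r s"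
    and rb: "rb = vec_space.rank r B"
    and rc: "rc = vec_space.rank n C"
    and p: "p = min rb rc"
    and N: "unitarily_invariant_norm r s N"
    and phi: "symmetric_gauge qbar \<phi>"
    and N_phi: "\<forall>Z\<in>carrier_mat r s. N Z = \<phi> (singular_values Z)"
    and F: "\<forall>X\<in>carrier_mat m n. F X = f (singular_values X)"
    and G: "\<forall>X\<in>carrier_mat m n. G X = g (singular_values X)"
    and f_proper: "proper_fun_on (carrier_vec q) f"
    and f_sym: "absolutely_symmetric q f"
    and g_proper: "proper_fun_on (carrier_vec q) g"
    and g_sym: "absolutely_symmetric q g"
    and l_proper: "proper_fun_on {0..} l"
    and l_mono: "mono_on {0..} l"
    and f_mono: "mono_weak_majorization q f"
    and g_mono: "mono_weak_majorization q g"
    and PB: "orthogonal_projector r PB (vec_space.col_space r B)"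
    and PC: "orthogonal_projector s PC (vec_space.row_space s C)"
    and iv1: "(1\<^sub>m r - PB) * A * PC = 0\<^sub>m r s"
    and iv2: "PB * A * (1\<^sub>m s - PC) = 0\<^sub>m r s"
    and svd_B: "thin_svd B UB SB VB"
    and svd_C: "thin_svd C UC SC VC"
    and UBp: "orthogonal_completion r UB UBp"
    and VCp: "orthogonal_completion s VC VCp"
    and At_diag: "diagonal_mat (UB\<^sup>T * A * VC)"
  shows
    "let At = UB\<^sup>T * A * VC;
         \<omega> = (\<lambda>x. singular_values
                 (four_block_mat (At - SB * Diag_rect rb rc x * SC) (0\<^sub>m rb (s - rc))
                                 (0\<^sub>m (r - rb) rc) (UBp\<^sup>T * A * VCp)));
         pad = (\<lambda>x. x @\<^sub>v 0\<^sub>v (q - p));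
         optP = optimal_solution {X \<in> carrier_mat m n. G X \<le> ereal c}
                  (\<lambda>X. l (N (A - B * X * C)) + ereal \<mu> * F X);
         optV = optimal_solution {x \<in> carrier_vec p. g (pad x) \<le> ereal c}
                  (\<lambda>x. l (\<phi> (\<omega> x)) + ereal \<mu> * f (pad x))
     in ((\<exists>X. optP X) \<longleftrightarrow> (\<exists>x. optV x)) \<and>
        (\<forall>x. optV x \<longrightarrow> optP (VB * Diag_rect rb rc x * UC\<^sup>T)) \<and>
        (\<forall>X. optP X \<longrightarrow> optV (diag_vec (VB\<^sup>T * X * UC)))"
proof -
  define Y where "Y = (\<lambda>X. VB\<^sup>T * X * UC)"
  define At where "At = UB\<^sup>T * A * VC"
  define D where "D = UBp\<^sup>T * A * VCp"
  define W where "W = (\<lambda>Z. four_block_mat (At - SB * Z * SC) (0\<^sub>m rb (s - rc)) (0\<^sub>m (r - rb) rc) D)"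
  define pad where "pad = (\<lambda>x :: real vec. x @\<^sub>v 0\<^sub>v (q - p))"
  let ?Diag = "Diag_rect rb rc"
  have cB: "compact_svd r m rb B UB SB VB" and cC: "compact_svd n s rc C UC SC VC"
    using compact_svd_of_thin_svd[OF svd_B B] compact_svd_of_thin_svd[OF svd_C C] rb rc by auto
  have UB: "UB \<in> carrier_mat r rb" and VB: "VB \<in> carrier_mat m rb" "VB\<^sup>T * VB = 1\<^sub>m rb"
    and SB: "SB \<in> carrier_mat rb rb" "diagonal_mat SB"
    and UC: "UC \<in> carrier_mat n rc" "UC\<^sup>T * UC = 1\<^sub>m rc" and VC: "VC \<in> carrier_mat s rc"
    and SC: "SC \<in> carrier_mat rc rc" "diagonal_mat SC"
    using cB cC by (auto simp: compact_svd_def)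
  have UBp': "UBp \<in> carrier_mat r (r - rb)" and VCp': "VCp \<in> carrier_mat s (s - rc)"
    using UBp VCp UB VC by (auto simp: orthogonal_completion_def)
  have rbr: "rb \<le> r" and rcs: "rc \<le> s"
    using orthogonal_completion_le[OF UBp UB] orthogonal_completion_le[OF VCp VC] .
  have pq: "p \<le> q"
    using orthonormal_columns_le_dim[OF VB] orthonormal_columns_le_dim[OF UC] p q by auto
  have At: "At \<in> carrier_mat rb rc" unfolding At_def using UB A VC by auto
  have Atd: "diagonal_mat At" unfolding At_def by (rule At_diag)
  have D: "D \<in> carrier_mat (r - rb) (s - rc)" unfolding D_def using UBp' A VCp' by auto
  have Diag: "?Diag x \<in> carrier_mat rb rc" for x by (simp add: Diag_rect_def)
  have Yc: "Y X \<in> carrier_mat rb rc" if "X \<in> carrier_mat m n" for X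
    unfolding Y_def using VB UC that by auto
  have Wc: "W Z \<in> carrier_mat r s" if "Z \<in> carrier_mat rb rc" for Z
  proof -
    have "At - SB * Z * SC \<in> carrier_mat rb rc" using SB SC that by (intro minus_carrier_mat) auto
    from four_block_carrier_mat[OF this D] show ?thesis unfolding W_def using rbr rcs by simp
  qed
  have residual: "N (A - B * X * C) = N (W (Y X))" if X: "X \<in> carrier_mat m n" for X
    unfolding W_def At_def D_def Y_def
  proof (rule residual_norm_block_form[OF N A B C X cB cC UBp VCp _ _ iv1 iv2])
    show "orthogonal_projector r PB {B *\<^sub>v x | x. x \<in> carrier_vec m}"
    proof -
      have "vec_space.col_space r B = {B *\<^sub>v x | x. x \<in> carrier_vec m}"
        using vec_space.col_space_eq[OF B] B by auto
      then show ?thesis using PB by simp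
    qed
    show "orthogonal_projector s PC {C\<^sup>T *\<^sub>v x | x. x \<in> carrier_vec n}"
    proof -
      have "vec_space.row_space s C = {C\<^sup>T *\<^sub>v x | x. x \<in> carrier_vec n}"
        using vec_space.col_space_eq[of "C\<^sup>T" s n] vec_space.row_space_eq_col_space_transpose[of s C] C by auto
      then show ?thesis using PC by simp
    qed
  qed
  have W_Diag: "N (W (?Diag x)) = \<phi> (singular_values (W (?Diag x)))" for x
    using N_phi Wc[OF Diag] by simp
  have N0: "0 \<le> N (W Z)" if "Z \<in> carrier_mat rb rc" for Z
    using N Wc[OF that] unfolding unitarily_invariant_norm_def norm_on_def by blast
  have le_X: "h (pad (diag_vec (Y X))) \<le> h (singular_values X)"
    if "absolutely_symmetric q h" "mono_weak_majorization q h" "X \<in> carrier_mat m n" for h X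
    unfolding Y_def pad_def by (rule spectral_function_diagonal_le[OF that(1,2) q VB UC p pq that(3)])
  have X_le: "h (singular_values (VB * ?Diag x * UC\<^sup>T)) \<le> h (pad x)"
    if "absolutely_symmetric q h" "mono_weak_majorization q h" "x \<in> carrier_vec p" for h x
    unfolding pad_def by (rule spectral_function_of_diagonal_le[OF that(1,2) q VB UC p pq that(3)])
  have scale: "ereal \<mu> * a \<le> ereal \<mu> * b" if "a \<le> b" for a b :: ereal
    using that mu by (intro ereal_mult_left_mono) auto
  have compress: "diag_vec (Y X) \<in> {x \<in> carrier_vec p. g (pad x) \<le> ereal c} \<and>
      l (\<phi> (singular_values (W (?Diag (diag_vec (Y X)))))) + ereal \<mu> * f (pad (diag_vec (Y X)))
      \<le> l (N (A - B * X * C)) + ereal \<mu> * F X"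
    if "X \<in> {X \<in> carrier_mat m n. G X \<le> ereal c}" for X
  proof -
    have X: "X \<in> carrier_mat m n" and GX: "G X \<le> ereal c" using that by auto
    have x: "diag_vec (Y X) \<in> carrier_vec p"
      using Yc[OF X] p by (intro carrier_vecI) (auto simp: diag_vec_def)
    have "g (pad (diag_vec (Y X))) \<le> ereal c"
      using le_X[OF g_sym g_mono X] bspec[OF G X] GX by simp
    moreover have "f (pad (diag_vec (Y X))) \<le> F X"
      using le_X[OF f_sym f_mono X] bspec[OF F X] by simp
    moreover have "N (W (?Diag (diag_vec (Y X)))) \<le> N (W (Y X))"
      using unitarily_invariant_norm_pinch_le[OF N Wc[OF Yc[OF X]], of "min rb rc"]
        pinch_residual_block[OF SB SC Yc[OF X] At Atd D] unfolding W_def by simp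
    then have "l (\<phi> (singular_values (W (?Diag (diag_vec (Y X)))))) \<le> l (N (A - B * X * C))"
      unfolding residual[OF X] W_Diag[symmetric] using N0 Diag Yc[OF X]
      by (intro mono_onD[OF l_mono]) auto
    ultimately show ?thesis using x by (auto intro!: add_mono scale)
  qed
  have lift: "VB * ?Diag x * UC\<^sup>T \<in> {X \<in> carrier_mat m n. G X \<le> ereal c} \<and>
      l (N (A - B * (VB * ?Diag x * UC\<^sup>T) * C)) + ereal \<mu> * F (VB * ?Diag x * UC\<^sup>T)
      \<le> l (\<phi> (singular_values (W (?Diag x)))) + ereal \<mu> * f (pad x)"
    if "x \<in> {x \<in> carrier_vec p. g (pad x) \<le> ereal c}" for x
  proof -
    let ?X = "VB * ?Diag x * UC\<^sup>T"
    have x: "x \<in> carrier_vec p" and gx: "g (pad x) \<le> ereal c" using that by auto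
    have X: "?X \<in> carrier_mat m n" using VB(1) UC(1) by (rule Diag_rect_sandwich_carrier)
    have "Y ?X = VB\<^sup>T * VB * ?Diag x * (UC\<^sup>T * UC)"
      unfolding Y_def using VB(1) UC(1) Diag[of x]
      by (simp add: assoc_mult_mat[of _ rb m _ rb _ rc] assoc_mult_mat[of _ m rb _ rc _ n]
          assoc_mult_mat[of _ rb m _ rc _ n] assoc_mult_mat[of _ rb m _ n _ rc]
          assoc_mult_mat[of _ m rb _ n _ rc] assoc_mult_mat[of _ rb rc _ n _ rc]
          assoc_mult_mat[of _ rb rb _ rc _ rc] assoc_mult_mat[of _ m rc _ n _ rc]
          assoc_mult_mat[of _ m rb _ rc _ rc] assoc_mult_mat[of _ rb m _ rc _ rc])
    then have "Y ?X = ?Diag x" unfolding VB(2) UC(2) using Diag[of x] by simp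
    then have "N (A - B * ?X * C) = \<phi> (singular_values (W (?Diag x)))"
      using residual[OF X] W_Diag by simp
    moreover have "G ?X \<le> ereal c" using X_le[OF g_sym g_mono x] bspec[OF G X] gx by simp
    moreover have "F ?X \<le> f (pad x)" using X_le[OF f_sym f_mono x] bspec[OF F X] by simp
    ultimately show ?thesis using X by (auto intro!: add_mono scale)
  qed
  show ?thesis
    unfolding Let_def
    using optimal_solution_transfer[OF compress lift]
    unfolding Y_def W_def At_def D_def pad_def .
qed

end
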